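(* Let $(\Gamma,L)$ be a periodic graph and let $x_0\in V_\Gamma$ be $P$-initial. For each vertex $v\in V(P_\Gamma)\setminus\{0\}$ pick a cycle $q_v$ of $\Gamma/L$ with $\mu(q_v)/w(q_v)=v$ and $\overline{x_0}\in\mathrm{supp}(q_v)$. Then $\mathrm{LCM}\{w(q_v): v\in V(P_\Gamma)\setminus\{0\}\}$ is a quasi-period of the growth sequence $(s_{\Gamma,x_0,d})_d$. More precisely, the growth series has the form $$G_{\Gamma,x_0}(t)=\frac{Q(t)}{\prod_{v\in V(P_\Gamma)\setminus\{0\}}(1-t^{w(q_v)})}$$ for some polynomial $Q(t)$. In particular, if $\Gamma$ is unweighted, then $\mathrm{LCM}\{1,2,\dots,\#(V_\Gamma/L)\}$ is a quasi-period of the growth sequence.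
   Context: A graph $\Gamma=(V_\Gamma,E_\Gamma,s,t,w)$ is a directed graph (loops and multiple edges allowed) with source/target maps $s,t$ and weight $w:E_\Gamma\to\mathbb Z_{>0}$; it is unweighted if $w\equiv1$. A walk is a sequence $p=e_1\cdots e_\ell$ of edges with $t(e_i)=s(e_{i+1})$; $w(p)=\sum w(e_i)$, $\mathrm{supp}(p)=\{s(e_1),t(e_1),\dots,t(e_\ell)\}$. A cycle is a walk with $\ell\ge1$, $s(e_1)=t(e_\ell)$ and $t(e_1),\dots,t(e_\ell)$ distinct. $d_\Gamma(x,y)$ is the minimum weight of a walk from $x$ to $y$ ($\infty$ if none). An $n$-dimensional periodic graph $(\Gamma,L)$: $L\cong\mathbb Z^n$ acts freely on $V_\Gamma$ and $E_\Gamma$ with finitely many orbits on each, compatibly with $s,t,w$. The quotient graph $\Gamma/L$ has vertices $V_\Gamma/L$, edges $E_\Gamma/L$; bars denote images. For a cycle $q$ of $\Gamma/L$, $\mu(q):=t(\tilde q)-s(\tilde q)\in L$ for any lift $\tilde q$ of $q$ to a walk in $\Gamma$ (where for $x,y$ in one orbit, $y-x\in L$ is the unique element sending $x$ to $y$). The growth polytope is $P_\Gamma:=\mathrm{conv}(\{\mu(q)/w(q): q \text{ a cycle of }\Gamma/L\}\cup\{0\})\subset L\otimes\mathbb R$, and $V(P_\Gamma)$ is its vertex set. A vertex $y$ is $P$-initial if for every $u\in V(P_\Gamma)\setminus\{0\}$ there is a cycle $p_u$ of $\Gamma/L$ with $\mu(p_u)/w(p_u)=u$ and $\overline y\in\mathrm{supp}(p_u)$.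 $s_{\Gamma,x_0,d}:=\#\{y: d_\Gamma(x_0,y)=d\}$ and $G_{\Gamma,x_0}(t):=\sum_{d\ge0}s_{\Gamma,x_0,d}t^d$. A function $g:\mathbb Z_{\ge0}\to\mathbb C$ has quasi-period $N\in\mathbb Z_{>0}$ if there are polynomials $Q_0,\dots,Q_{N-1}$ such that $g(m)=Q_j(m)$ for all sufficiently large $m$ with $m\equiv j\pmod N$. *)

theory Defs
  imports
    "HOL-Analysis.Analysis"
    "HOL-Computational_Algebra.Computational_Algebra"
    "Graph_Theory.Arc_Walk"
begin

text \<open>
  A group \<open>L \<cong> \<int>\<^sup>n\<close> is realised as the integer span of \<open>n\<close> linearly independent
  vectors of a Euclidean space, so that \<open>L \<otimes> \<real>\<close> is the real span of \<open>L\<close> there.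
  (Unlike an index type, this also covers \<open>n = 0\<close>.)
\<close>

definition lattice_of_rank :: "nat \<Rightarrow> 'l::euclidean_space set \<Rightarrow> bool" where
  "lattice_of_rank n L \<longleftrightarrow>
     (\<exists>B. independent B \<and> card B = n \<and>
          L = {\<Sum>b\<in>B. real_of_int (c b) *\<^sub>R b | c. True})"

record ('v, 'e, 'l) periodic_graph_data =
  digraph_of :: "('v, 'e) pre_digraph"
  weight :: "'e \<Rightarrow> nat"
  lattice :: "'l set"
  vact :: "'l \<Rightarrow> 'v \<Rightarrow> 'v"
  eact :: "'l \<Rightarrow> 'e \<Rightarrow> 'e"

definition vorbit :: "('v, 'e, 'l) periodic_graph_data \<Rightarrow> 'v \<Rightarrow> 'v set" where
  "vorbit \<Gamma> x = (\<lambda>a. vact \<Gamma> a x) ` lattice \<Gamma>"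

definition eorbit :: "('v, 'e, 'l) periodic_graph_data \<Rightarrow> 'e \<Rightarrow> 'e set" where
  "eorbit \<Gamma> e = (\<lambda>a. eact \<Gamma> a e) ` lattice \<Gamma>"

locale periodic_graph =
  fixes n :: nat and \<Gamma> :: "('v, 'e, 'l::euclidean_space) periodic_graph_data"
  assumes wf: "wf_digraph (digraph_of \<Gamma>)"
    and weight_pos: "e \<in> arcs (digraph_of \<Gamma>) \<Longrightarrow> weight \<Gamma> e > 0"
    and lattice: "lattice_of_rank n (lattice \<Gamma>)"
    and vact_closed: "\<lbrakk>a \<in> lattice \<Gamma>; x \<in> verts (digraph_of \<Gamma>)\<rbrakk> \<Longrightarrow> vact \<Gamma> a x \<in> verts (digraph_of \<Gamma>)"
    and vact_zero: "x \<in> verts (digraph_of \<Gamma>) \<Longrightarrow> vact \<Gamma> 0 x = x"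
    and vact_add: "\<lbrakk>a \<in> lattice \<Gamma>; b \<in> lattice \<Gamma>; x \<in> verts (digraph_of \<Gamma>)\<rbrakk>
        \<Longrightarrow> vact \<Gamma> (a + b) x = vact \<Gamma> a (vact \<Gamma> b x)"
    and vact_free: "\<lbrakk>a \<in> lattice \<Gamma>; x \<in> verts (digraph_of \<Gamma>); vact \<Gamma> a x = x\<rbrakk> \<Longrightarrow> a = 0"
    and eact_closed: "\<lbrakk>a \<in> lattice \<Gamma>; e \<in> arcs (digraph_of \<Gamma>)\<rbrakk> \<Longrightarrow> eact \<Gamma> a e \<in> arcs (digraph_of \<Gamma>)"
    and eact_zero: "e \<in> arcs (digraph_of \<Gamma>) \<Longrightarrow> eact \<Gamma> 0 e = e"
    and eact_add: "\<lbrakk>a \<in> lattice \<Gamma>; b \<in> lattice \<Gamma>; e \<in> arcs (digraph_of \<Gamma>)\<rbrakk>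
        \<Longrightarrow> eact \<Gamma> (a + b) e = eact \<Gamma> a (eact \<Gamma> b e)"
    and eact_free: "\<lbrakk>a \<in> lattice \<Gamma>; e \<in> arcs (digraph_of \<Gamma>); eact \<Gamma> a e = e\<rbrakk> \<Longrightarrow> a = 0"
    and finite_vorbits: "finite (vorbit \<Gamma> ` verts (digraph_of \<Gamma>))"
    and finite_eorbits: "finite (eorbit \<Gamma> ` arcs (digraph_of \<Gamma>))"
    and tail_eact: "\<lbrakk>a \<in> lattice \<Gamma>; e \<in> arcs (digraph_of \<Gamma>)\<rbrakk>
        \<Longrightarrow> tail (digraph_of \<Gamma>) (eact \<Gamma> a e) = vact \<Gamma> a (tail (digraph_of \<Gamma>) e)"
    and head_eact: "\<lbrakk>a \<in> lattice \<Gamma>; e \<in> arcs (digraph_of \<Gamma>)\<rbrakk>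
        \<Longrightarrow> head (digraph_of \<Gamma>) (eact \<Gamma> a e) = vact \<Gamma> a (head (digraph_of \<Gamma>) e)"
    and weight_eact: "\<lbrakk>a \<in> lattice \<Gamma>; e \<in> arcs (digraph_of \<Gamma>)\<rbrakk>
        \<Longrightarrow> weight \<Gamma> (eact \<Gamma> a e) = weight \<Gamma> e"

text \<open>
  By equivariance, the image of an edge orbit under the source (target) map is exactly
  the orbit of the source (target), and the weight is constant on it.
\<close>

definition quotient_graph :: "('v, 'e, 'l) periodic_graph_data \<Rightarrow> ('v set, 'e set) pre_digraph" where
  "quotient_graph \<Gamma> =
     \<lparr>verts = vorbit \<Gamma> ` verts (digraph_of \<Gamma>),
      arcs = eorbit \<Gamma> ` arcs (digraph_of \<Gamma>),
      tail = (\<lambda>C. tail (digraph_of \<Gamma>) ` C),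
      head = (\<lambda>C. head (digraph_of \<Gamma>) ` C)\<rparr>"

definition quotient_weight :: "('v, 'e, 'l) periodic_graph_data \<Rightarrow> 'e set \<Rightarrow> nat" where
  "quotient_weight \<Gamma> C = the_elem (weight \<Gamma> ` C)"

definition walk_weight :: "('e \<Rightarrow> nat) \<Rightarrow> 'e list \<Rightarrow> nat" where
  "walk_weight w p = sum_list (map w p)"

text \<open>The support of a walk, for walks with at least one edge.\<close>

definition walk_supp :: "('v, 'e) pre_digraph \<Rightarrow> 'e list \<Rightarrow> 'v set" where
  "walk_supp G p = insert (tail G (hd p)) (head G ` set p)"

definition is_quotient_cycle :: "('v, 'e, 'l) periodic_graph_data \<Rightarrow> 'e set list \<Rightarrow> bool" where
  "is_quotient_cycle \<Gamma> q \<longleftrightarrow> pre_digraph.cycle (quotient_graph \<Gamma>) q"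

abbreviation cycle_weight :: "('v, 'e, 'l) periodic_graph_data \<Rightarrow> 'e set list \<Rightarrow> nat" where
  "cycle_weight \<Gamma> \<equiv> walk_weight (quotient_weight \<Gamma>)"

text \<open>
  The displacement \<open>\<mu>(q)\<close>: the unique \<open>a \<in> L\<close> such that some (equivalently, by
  \<open>cycle_displacement_eq\<close> below, every) lift of \<open>q\<close> leads from a vertex \<open>x\<close> to \<open>a + x\<close>.
\<close>

definition cycle_displacement ::
    "('v, 'e, 'l) periodic_graph_data \<Rightarrow> 'e set list \<Rightarrow> 'l" where
  "cycle_displacement \<Gamma> q =
     (THE a. a \<in> lattice \<Gamma> \<and>
        (\<exists>x p. pre_digraph.awalk (digraph_of \<Gamma>) x p (vact \<Gamma> a x) \<and> map (eorbit \<Gamma>) p = q))"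

definition cycle_direction ::
    "('v, 'e, 'l::euclidean_space) periodic_graph_data \<Rightarrow> 'e set list \<Rightarrow> 'l" where
  "cycle_direction \<Gamma> q = cycle_displacement \<Gamma> q /\<^sub>R real (cycle_weight \<Gamma> q)"

definition growth_polytope ::
    "('v, 'e, 'l::euclidean_space) periodic_graph_data \<Rightarrow> 'l set" where
  "growth_polytope \<Gamma> =
     convex hull ({cycle_direction \<Gamma> q | q. is_quotient_cycle \<Gamma> q} \<union> {0})"

definition polytope_vertices :: "'l::euclidean_space set \<Rightarrow> 'l set" where
  "polytope_vertices P = {v. v extreme_point_of P}"

definition P_initial ::
    "('v, 'e, 'l::euclidean_space) periodic_graph_data \<Rightarrow> 'v \<Rightarrow> bool" where
  "P_initial \<Gamma> y \<longleftrightarrow>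
     y \<in> verts (digraph_of \<Gamma>) \<and>
     (\<forall>u \<in> polytope_vertices (growth_polytope \<Gamma>) - {0}.
        \<exists>p. is_quotient_cycle \<Gamma> p \<and> cycle_direction \<Gamma> p = u \<and>
            vorbit \<Gamma> y \<in> walk_supp (quotient_graph \<Gamma>) p)"

text \<open>
  On \<^typ>\<open>enat\<close> the infimum of a nonempty set is its minimum, and that of the empty set is \<open>\<infinity>\<close>.
\<close>

definition graph_dist :: "('v, 'e, 'l) periodic_graph_data \<Rightarrow> 'v \<Rightarrow> 'v \<Rightarrow> enat" where
  "graph_dist \<Gamma> x y =
     (INF p \<in> {p. pre_digraph.awalk (digraph_of \<Gamma>) x p y}. enat (walk_weight (weight \<Gamma>) p))"

definition growth_seq :: "('v, 'e, 'l) periodic_graph_data \<Rightarrow> 'v \<Rightarrow> nat \<Rightarrow> nat" where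
  "growth_seq \<Gamma> x d = card {y \<in> verts (digraph_of \<Gamma>). graph_dist \<Gamma> x y = enat d}"

definition growth_series :: "('v, 'e, 'l) periodic_graph_data \<Rightarrow> 'v \<Rightarrow> complex fps" where
  "growth_series \<Gamma> x = Abs_fps (\<lambda>d. of_nat (growth_seq \<Gamma> x d))"

definition has_quasi_period :: "(nat \<Rightarrow> complex) \<Rightarrow> nat \<Rightarrow> bool" where
  "has_quasi_period g N \<longleftrightarrow>
     N > 0 \<and>
     (\<exists>Q :: nat \<Rightarrow> complex poly. \<forall>j<N.
        \<forall>\<^sub>F m in sequentially. m mod N = j \<longrightarrow> g m = poly (Q j) (of_nat m))"

definition unweighted :: "('v, 'e, 'l) periodic_graph_data \<Rightarrow> bool" where
  "unweighted \<Gamma> \<longleftrightarrow> (\<forall>e \<in> arcs (digraph_of \<Gamma>). weight \<Gamma> e = 1)"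

lemma lattice_of_rank_closed:
  assumes "lattice_of_rank n L"
  shows "0 \<in> L" and "a \<in> L \<Longrightarrow> b \<in> L \<Longrightarrow> a - b \<in> L" and "a \<in> L \<Longrightarrow> b \<in> L \<Longrightarrow> a + b \<in> L"
proof -
  obtain B where L: "L = {\<Sum>b\<in>B. real_of_int (c b) *\<^sub>R b | c. True}"
    using assms by (auto simp: lattice_of_rank_def)
  show "0 \<in> L"
    unfolding L by (rule CollectI, rule exI[of _ "\<lambda>_. 0"]) simp
  show "a - b \<in> L" if ab: "a \<in> L" "b \<in> L"
  proof -
    obtain c d where "a = (\<Sum>b\<in>B. real_of_int (c b) *\<^sub>R b)" "b = (\<Sum>b\<in>B. real_of_int (d b) *\<^sub>R b)"
      using ab L by auto
    then have "a - b = (\<Sum>b\<in>B. real_of_int (c b - d b) *\<^sub>R b)"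
      by (simp add: sum_subtractf scaleR_diff_left)
    then show ?thesis unfolding L by (intro CollectI exI[of _ "\<lambda>b. c b - d b"]) simp
  qed
  show "a + b \<in> L" if ab: "a \<in> L" "b \<in> L"
  proof -
    obtain c d where "a = (\<Sum>b\<in>B. real_of_int (c b) *\<^sub>R b)" "b = (\<Sum>b\<in>B. real_of_int (d b) *\<^sub>R b)"
      using ab L by auto
    then have "a + b = (\<Sum>b\<in>B. real_of_int (c b + d b) *\<^sub>R b)"
      by (simp add: sum.distrib scaleR_add_left)
    then show ?thesis unfolding L by (intro CollectI exI[of _ "\<lambda>b. c b + d b"]) simp
  qed
qed

context periodic_graph
begin

lemmas lattice_zero = lattice_of_rank_closed(1)[OF lattice]
  and lattice_diff = lattice_of_rank_closed(2)[OF lattice]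
  and lattice_add = lattice_of_rank_closed(3)[OF lattice]

lemma lattice_uminus: "a \<in> lattice \<Gamma> \<Longrightarrow> - a \<in> lattice \<Gamma>"
  using lattice_diff[OF lattice_zero] by simp

lemma vact_inj:
  assumes "a \<in> lattice \<Gamma>" "b \<in> lattice \<Gamma>" "x \<in> verts (digraph_of \<Gamma>)" "vact \<Gamma> a x = vact \<Gamma> b x"
  shows "a = b"
proof -
  have "vact \<Gamma> (- b + a) x = vact \<Gamma> (- b + b) x"
    using assms by (simp only: vact_add lattice_uminus)
  then have "- b + a = 0"
    using assms vact_zero by (intro vact_free[of _ x] lattice_add lattice_uminus) auto
  then show ?thesis by simp
qed

lemma vorbit_self: "x \<in> verts (digraph_of \<Gamma>) \<Longrightarrow> x \<in> vorbit \<Gamma> x"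
  unfolding vorbit_def using vact_zero lattice_zero by force

lemma eorbit_self: "e \<in> arcs (digraph_of \<Gamma>) \<Longrightarrow> e \<in> eorbit \<Gamma> e"
  unfolding eorbit_def using eact_zero lattice_zero by force

lemma tail_eorbit: "e \<in> arcs (digraph_of \<Gamma>) \<Longrightarrow> tail (digraph_of \<Gamma>) ` eorbit \<Gamma> e = vorbit \<Gamma> (tail (digraph_of \<Gamma>) e)"
  by (auto simp: eorbit_def vorbit_def tail_eact image_image)

lemma head_eorbit: "e \<in> arcs (digraph_of \<Gamma>) \<Longrightarrow> head (digraph_of \<Gamma>) ` eorbit \<Gamma> e = vorbit \<Gamma> (head (digraph_of \<Gamma>) e)"
  by (auto simp: eorbit_def vorbit_def head_eact image_image)

lemma quotient_weight_eorbit: "e \<in> arcs (digraph_of \<Gamma>) \<Longrightarrow> quotient_weight \<Gamma> (eorbit \<Gamma> e) = weight \<Gamma> e"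
proof -
  assume "e \<in> arcs (digraph_of \<Gamma>)"
  then have "weight \<Gamma> ` eorbit \<Gamma> e = {weight \<Gamma> e}"
    using lattice_zero by (auto simp: eorbit_def weight_eact image_image)
  then show ?thesis by (simp add: quotient_weight_def)
qed

lemma eorbit_eact: 
  assumes "a \<in> lattice \<Gamma>" "e \<in> arcs (digraph_of \<Gamma>)" 
  shows "eorbit \<Gamma> (eact \<Gamma> a e) = eorbit \<Gamma> e"
proof -
  have "eact \<Gamma> b e \<in> eorbit \<Gamma> (eact \<Gamma> a e)" if "b \<in> lattice \<Gamma>" for b
  proof -
    have "eact \<Gamma> (b - a) (eact \<Gamma> a e) = eact \<Gamma> b e"
      using that assms by (simp add: eact_add[symmetric] lattice_diff)
    then show ?thesis unfolding eorbit_def using that assms lattice_diff by (metis imageI)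
  qed
  moreover have "eact \<Gamma> b (eact \<Gamma> a e) \<in> eorbit \<Gamma> e" if "b \<in> lattice \<Gamma>" for b
    using that assms by (simp add: eorbit_def eact_add[symmetric] lattice_add)
  ultimately show ?thesis by (auto simp: eorbit_def)
qed

lemma wf_quotient_graph: "wf_digraph (quotient_graph \<Gamma>)"
proof -
  interpret wf_digraph "digraph_of \<Gamma>" by (rule wf)
  show ?thesis
    by unfold_locales (auto simp: quotient_graph_def tail_eorbit head_eorbit)
qed

lemma quotient_graph_sel:
  "verts (quotient_graph \<Gamma>) = vorbit \<Gamma> ` verts (digraph_of \<Gamma>)"
  "arcs (quotient_graph \<Gamma>) = eorbit \<Gamma> ` arcs (digraph_of \<Gamma>)"
  "tail (quotient_graph \<Gamma>) C = tail (digraph_of \<Gamma>) ` C"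
  "head (quotient_graph \<Gamma>) C = head (digraph_of \<Gamma>) ` C"
  by (simp_all add: quotient_graph_def)

lemma lift_walk:
  assumes "pre_digraph.awalk (quotient_graph \<Gamma>) X q Y" "x \<in> X"
  shows "\<exists>p y. pre_digraph.awalk (digraph_of \<Gamma>) x p y \<and> map (eorbit \<Gamma>) p = q \<and> y \<in> Y"
  using assms
proof (induction q arbitrary: X x)
  interpret G: wf_digraph "digraph_of \<Gamma>" by (rule wf)
  interpret Q: wf_digraph "quotient_graph \<Gamma>" by (rule wf_quotient_graph)
  case Nil
  then have "X = Y" "x \<in> verts (digraph_of \<Gamma>)"
    by (auto simp: Q.awalk_Nil_iff quotient_graph_sel vorbit_def vact_closed)
  then show ?case using Nil by (intro exI[of _ "[]"] exI[of _ x]) (simp add: G.awalk_Nil_iff)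
next
  interpret G: wf_digraph "digraph_of \<Gamma>" by (rule wf)
  interpret Q: wf_digraph "quotient_graph \<Gamma>" by (rule wf_quotient_graph)
  case (Cons C q)
  then obtain e where e: "e \<in> arcs (digraph_of \<Gamma>)" "C = eorbit \<Gamma> e" "X = vorbit \<Gamma> (tail (digraph_of \<Gamma>) e)"
      and w: "Q.awalk (vorbit \<Gamma> (head (digraph_of \<Gamma>) e)) q Y"
    by (auto simp: Q.awalk_Cons_iff quotient_graph_sel tail_eorbit head_eorbit)
  then obtain a where a: "a \<in> lattice \<Gamma>" "x = vact \<Gamma> a (tail (digraph_of \<Gamma>) e)"
    using Cons.prems by (auto simp: vorbit_def)
  have "head (digraph_of \<Gamma>) (eact \<Gamma> a e) \<in> vorbit \<Gamma> (head (digraph_of \<Gamma>) e)"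
    using a e by (simp add: head_eact vorbit_def)
  from Cons.IH[OF w this] obtain p y where
    "G.awalk (head (digraph_of \<Gamma>) (eact \<Gamma> a e)) p y" "map (eorbit \<Gamma>) p = q" "y \<in> Y" by blast
  then show ?case using a e
    by (intro exI[of _ "eact \<Gamma> a e # p"] exI[of _ y])
      (simp add: G.awalk_Cons_iff eact_closed tail_eact eorbit_eact)
qed

lemma lift_translate:
  assumes "pre_digraph.awalk (digraph_of \<Gamma>) x p y" "pre_digraph.awalk (digraph_of \<Gamma>) (vact \<Gamma> a x) p' y'"
    and "map (eorbit \<Gamma>) p = map (eorbit \<Gamma>) p'" "a \<in> lattice \<Gamma>"
  shows "y' = vact \<Gamma> a y"
  using assms
proof (induction p arbitrary: x p')
  interpret G: wf_digraph "digraph_of \<Gamma>" by (rule wf)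
  case Nil
  then show ?case by (simp add: G.awalk_Nil_iff)
next
  interpret G: wf_digraph "digraph_of \<Gamma>" by (rule wf)
  case (Cons e p)
  then obtain e' r where p': "p' = e' # r" and o: "eorbit \<Gamma> e = eorbit \<Gamma> e'"
    "map (eorbit \<Gamma>) p = map (eorbit \<Gamma>) r" by (cases p') auto
  have e: "e \<in> arcs (digraph_of \<Gamma>)" "x = tail (digraph_of \<Gamma>) e" "G.awalk (head (digraph_of \<Gamma>) e) p y"
    and e': "e' \<in> arcs (digraph_of \<Gamma>)" "vact \<Gamma> a x = tail (digraph_of \<Gamma>) e'" "G.awalk (head (digraph_of \<Gamma>) e') r y'"
    using Cons.prems by (auto simp: p' G.awalk_Cons_iff)
  from eorbit_self[OF e'(1)] o obtain b where b: "b \<in> lattice \<Gamma>" "e' = eact \<Gamma> b e"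
    by (auto simp: eorbit_def)
  have "b = a" using vact_inj[of b a x] b e e' Cons.prems by (simp add: tail_eact)
  then have "head (digraph_of \<Gamma>) e' = vact \<Gamma> a (head (digraph_of \<Gamma>) e)"
    using b e by (simp add: head_eact)
  then show ?case using Cons.IH[OF e(3) _ o(2) Cons.prems(4)] e'(3) by simp
qed

lemma lift_displacement_unique:
  assumes "pre_digraph.awalk (digraph_of \<Gamma>) x p (vact \<Gamma> a x)" "a \<in> lattice \<Gamma>"
    and "pre_digraph.awalk (digraph_of \<Gamma>) x' p' (vact \<Gamma> b x')" "b \<in> lattice \<Gamma>"
    and "map (eorbit \<Gamma>) p = map (eorbit \<Gamma>) p'" "p \<noteq> []"
  shows "a = b"
proof -
  interpret G: wf_digraph "digraph_of \<Gamma>" by (rule wf)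
  obtain e r e' r' where p: "p = e # r" "p' = e' # r'" using assms by (cases p; cases p') auto
  then have e: "e \<in> arcs (digraph_of \<Gamma>)" "x = tail (digraph_of \<Gamma>) e" "e' \<in> arcs (digraph_of \<Gamma>)" "x' = tail (digraph_of \<Gamma>) e'"
    using assms by (auto simp: G.awalk_Cons_iff)
  from eorbit_self[OF e(3)] assms(5) p obtain c where c: "c \<in> lattice \<Gamma>" "e' = eact \<Gamma> c e"
    by (auto simp: eorbit_def)
  then have x': "x' = vact \<Gamma> c x" and x: "x \<in> verts (digraph_of \<Gamma>)" using e by (auto simp: tail_eact)
  have "vact \<Gamma> b x' = vact \<Gamma> c (vact \<Gamma> a x)"
    using lift_translate[OF assms(1) _ assms(5) c(1)] assms(3) x' by simp
  then have "vact \<Gamma> (b + c) x = vact \<Gamma> (c + a) x"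
    using x x' assms c by (simp add: vact_add)
  then have "b + c = c + a" using x c assms by (intro vact_inj[of _ _ x] lattice_add) auto
  then show ?thesis by simp
qed

lemma cycle_displacement_eq:
  assumes "is_quotient_cycle \<Gamma> q" "pre_digraph.awalk (digraph_of \<Gamma>) x p (vact \<Gamma> a x)" "a \<in> lattice \<Gamma>"
    and "map (eorbit \<Gamma>) p = q"
  shows "cycle_displacement \<Gamma> q = a"
proof -
  have "p \<noteq> []" using assms(1,4) by (auto simp: is_quotient_cycle_def pre_digraph.cycle_def)
  then show ?thesis
    unfolding cycle_displacement_def using assms
    by (intro the_equality) (blast, metis lift_displacement_unique)
qed

lemma quotient_cycle_lift:
  assumes "is_quotient_cycle \<Gamma> q"
  obtains x p where "pre_digraph.awalk (digraph_of \<Gamma>) x p (vact \<Gamma> (cycle_displacement \<Gamma> q) x)"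
    "map (eorbit \<Gamma>) p = q" "cycle_displacement \<Gamma> q \<in> lattice \<Gamma>"
proof -
  interpret Q: wf_digraph "quotient_graph \<Gamma>" by (rule wf_quotient_graph)
  from assms obtain X where X: "Q.awalk X q X" by (auto simp: is_quotient_cycle_def Q.cycle_def)
  then obtain x where x: "x \<in> verts (digraph_of \<Gamma>)" "X = vorbit \<Gamma> x"
    using Q.awalk_hd_in_verts[OF X] by (auto simp: quotient_graph_sel)
  from lift_walk[OF X] vorbit_self x obtain p y where
    "pre_digraph.awalk (digraph_of \<Gamma>) x p y" "map (eorbit \<Gamma>) p = q" "y \<in> X" by blast
  moreover from this x obtain a where "a \<in> lattice \<Gamma>" "y = vact \<Gamma> a x" by (auto simp: vorbit_def)
  ultimately show ?thesis using cycle_displacement_eq[OF assms, of x p a] that by simp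
qed

end

end

theory Submission
  imports Defs
begin

text \<open>
  Let \<open>B\<close> be the set of pairs \<open>(y, d)\<close> with \<open>d(x\<^sub>0, y) \<le> d\<close>. Since each \<open>q\<^sub>v\<close> passes through the image
  of \<open>x\<^sub>0\<close>, prepending a lift of it to walks from \<open>x\<^sub>0\<close> shows that \<open>B\<close> is stable under the
  monoid \<open>M\<close> generated by \<open>(0, 1)\<close> and all \<open>(\<mu>(q\<^sub>v), w(q\<^sub>v))\<close>. Moreover \<open>B\<close> is finitely generated over \<open>M\<close>:
  a walk in the quotient splits into a walk of bounded length and cycles meeting it, and a
  positive multiple of every \<open>(\<mu>(c), w(c))\<close> lies in \<open>M\<close>, because \<open>\<mu>(c) / w(c)\<close> lies in the convex hull of \<open>0\<close>
  and the vertices \<open>v\<close>; so only bounded multiplicities of the cycles are needed in generators.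
  As for a finitely generated graded module, the generating function of \<open>B\<close> by \<open>d\<close> is
  a polynomial over \<open>(1 - t) \<Prod>\<^sub>v (1 - t\<^bsup>w(q\<^sub>v)\<^esup>)\<close>, and the growth series is \<open>1 - t\<close> times it.
\<close>

section \<open>Hilbert series of sets of exponent vectors\<close>

text \<open>\<open>card\<close> is 0 on infinite sets, so the coefficients count elements only when
  every degree has finitely many; hence the finiteness hypotheses below.\<close>

definition hilbert_series :: "('a \<Rightarrow> nat) \<Rightarrow> 'a set \<Rightarrow> complex fps" where
  "hilbert_series deg A = Abs_fps (\<lambda>d. of_nat (card {a \<in> A. deg a = d}))"

text \<open>\<open>H = Q / D\<close> with the denominator multiplied out, so that no invertibility
  of \<open>D\<close> enters.\<close>

definition rational_over :: "complex fps \<Rightarrow> complex fps \<Rightarrow> bool" where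
  "rational_over D H \<longleftrightarrow> (\<exists>Q. H * D = fps_of_poly Q)"

lemma hilbert_series_nth [simp]:
  "fps_nth (hilbert_series deg A) d = of_nat (card {a \<in> A. deg a = d})"
  by (simp add: hilbert_series_def)

lemma hilbert_series_Un:
  assumes "A \<inter> B = {}" "\<And>d. finite {a \<in> A. deg a = d}" "\<And>d. finite {a \<in> B. deg a = d}"
  shows "hilbert_series deg (A \<union> B) = hilbert_series deg A + hilbert_series deg B"
proof (rule fps_ext)
  fix d
  have "{a \<in> A \<union> B. deg a = d} = {a \<in> A. deg a = d} \<union> {a \<in> B. deg a = d}" by auto
  moreover have "card \<dots> = card {a \<in> A. deg a = d} + card {a \<in> B. deg a = d}"
    using assms by (intro card_Un_disjoint) auto
  ultimately show "fps_nth (hilbert_series deg (A \<union> B)) d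
      = fps_nth (hilbert_series deg A + hilbert_series deg B) d" by simp
qed

lemma hilbert_series_UN:
  assumes "finite I" "disjoint_family_on A I" "\<And>i d. i \<in> I \<Longrightarrow> finite {a \<in> A i. deg a = d}"
  shows "hilbert_series deg (\<Union>i\<in>I. A i) = (\<Sum>i\<in>I. hilbert_series deg (A i))"
  using assms
proof (induction I rule: finite_induct)
  case empty
  then show ?case by (simp add: fps_eq_iff)
next
  case (insert i I)
  have "{a \<in> \<Union>i\<in>I. A i. deg a = d} = (\<Union>i\<in>I. {a \<in> A i. deg a = d})" for d by auto
  then have fin: "finite {a \<in> \<Union>i\<in>I. A i. deg a = d}" for d
    using insert by auto
  have "A i \<inter> (\<Union>i\<in>I. A i) = {}"
    using insert.hyps insert.prems(1) by (auto simp: disjoint_family_on_def)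
  then have "hilbert_series deg (A i \<union> (\<Union>i\<in>I. A i))
      = hilbert_series deg (A i) + hilbert_series deg (\<Union>i\<in>I. A i)"
    using insert.prems(2) fin by (intro hilbert_series_Un) auto
  moreover have "disjoint_family_on A I"
    using insert.prems(1) by (auto simp: disjoint_family_on_def)
  ultimately show ?case using insert by simp
qed

lemma hilbert_series_image:
  assumes "inj_on f A" "\<And>a. a \<in> A \<Longrightarrow> deg' (f a) = deg a + k"
  shows "hilbert_series deg' (f ` A) = fps_X ^ k * hilbert_series deg A"
proof (rule fps_ext)
  fix d
  have "{b \<in> f ` A. deg' b = d} = f ` {a \<in> A. deg a + k = d}" using assms(2) by auto
  moreover have "card \<dots> = card {a \<in> A. deg a + k = d}"
    using assms(1) by (intro card_image) (auto simp: inj_on_def)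
  moreover have "{a \<in> A. deg a + k = d} = (if d < k then {} else {a \<in> A. deg a = d - k})" by auto
  ultimately show "fps_nth (hilbert_series deg' (f ` A)) d
      = fps_nth (fps_X ^ k * hilbert_series deg A) d"
    by (simp add: fps_X_power_mult_nth)
qed

lemma rational_over_add: "rational_over D G \<Longrightarrow> rational_over D H \<Longrightarrow> rational_over D (G + H)"
  unfolding rational_over_def by (metis distrib_right fps_of_poly_add)

lemma rational_over_diff: "rational_over D G \<Longrightarrow> rational_over D H \<Longrightarrow> rational_over D (G - H)"
  unfolding rational_over_def by (metis left_diff_distrib fps_of_poly_diff)

lemma rational_over_X_power_mult: "rational_over D H \<Longrightarrow> rational_over D (fps_X ^ k * H)"
  unfolding rational_over_def
  by (metis fps_of_poly_mult fps_of_poly_monom' mult.assoc)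

lemma rational_over_zero: "rational_over D 0"
  unfolding rational_over_def by (metis mult_zero_left fps_of_poly_0)

lemma rational_over_sum:
  "(\<And>i. i \<in> I \<Longrightarrow> rational_over D (H i)) \<Longrightarrow> rational_over D (\<Sum>i\<in>I. H i)"
  by (induction I rule: infinite_finite_induct) (auto simp: rational_over_zero rational_over_add)

lemma rational_over_mult_denominator:
  assumes "rational_over D H"
  shows "rational_over ((1 - fps_X ^ k) * D) H"
proof -
  obtain Q where "H * D = fps_of_poly Q" using assms by (auto simp: rational_over_def)
  then have "H * ((1 - fps_X ^ k) * D) = fps_of_poly ((1 - monom 1 k) * Q)"
    by (simp add: fps_of_poly_mult fps_of_poly_diff fps_of_poly_monom' mult_ac)
  then show ?thesis unfolding rational_over_def ..
qed

section \<open>Monomial ideals and their Hilbert series\<close>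

definition exponents :: "'j set \<Rightarrow> ('j \<Rightarrow> nat) set" where
  "exponents J = {c. \<forall>j. j \<notin> J \<longrightarrow> c j = 0}"

definition exponent_degree :: "('j \<Rightarrow> nat) \<Rightarrow> 'j set \<Rightarrow> ('j \<Rightarrow> nat) \<Rightarrow> nat" where
  "exponent_degree w J c = (\<Sum>j\<in>J. c j * w j)"

text \<open>The exponent sets of monomial ideals in the variables \<open>J\<close>.\<close>

definition up_closed :: "'j set \<Rightarrow> ('j \<Rightarrow> nat) set \<Rightarrow> bool" where
  "up_closed J U \<longleftrightarrow> U \<subseteq> exponents J \<and> (\<forall>c\<in>U. \<forall>c'\<in>exponents J. c \<le> c' \<longrightarrow> c' \<in> U)"

lemma finite_exponents_degree:
  assumes "finite J" "\<And>j. j \<in> J \<Longrightarrow> w j > 0"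
  shows "finite {c \<in> exponents J. exponent_degree w J c = d}"
proof (rule finite_subset)
  show "finite {c. \<forall>j. (j \<in> J \<longrightarrow> c j \<in> {..d}) \<and> (j \<notin> J \<longrightarrow> c j = 0)}"
    using assms(1) by (intro finite_set_of_finite_funs) auto
  have "c j \<le> exponent_degree w J c" if "j \<in> J" for c j
  proof -
    have "c j \<le> c j * w j" using assms(2)[OF that] by simp
    also have "\<dots> \<le> exponent_degree w J c"
      unfolding exponent_degree_def using that assms(1) by (intro member_le_sum) auto
    finally show ?thesis .
  qed
  then show "{c \<in> exponents J. exponent_degree w J c = d}
      \<subseteq> {c. \<forall>j. (j \<in> J \<longrightarrow> c j \<in> {..d}) \<and> (j \<notin> J \<longrightarrow> c j = 0)}"
    by (auto simp: exponents_def)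
qed

text \<open>Every sequence has a monotone subsequence; a decreasing one of natural numbers is
  constant from the point where it attains its minimum.\<close>

lemma exists_mono_subseq_nat:
  fixes f :: "nat \<Rightarrow> nat"
  shows "\<exists>r :: nat \<Rightarrow> nat. strict_mono r \<and> mono (f \<circ> r)"
proof -
  obtain r where r: "strict_mono (r :: nat \<Rightarrow> nat)" "monoseq (f \<circ> r)"
    using seq_monosub[of f] by (auto simp: o_def)
  show ?thesis
  proof (cases "mono (f \<circ> r)")
    case False
    then have dec: "n \<le> m \<Longrightarrow> f (r m) \<le> f (r n)" for m n
      using r(2) by (auto simp: monoseq_def mono_def)
    define k where "k = (LEAST v. v \<in> range (f \<circ> r))"
    have "k \<in> range (f \<circ> r)" unfolding k_def by (rule LeastI[of _ "f (r 0)"]) auto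
    then obtain n where n: "f (r n) = k" by auto
    have "f (r (n + m)) = k" for m
    proof (rule antisym)
      show "f (r (n + m)) \<le> k" using dec[of n "n + m"] n by simp
      show "k \<le> f (r (n + m))" unfolding k_def by (rule Least_le) auto
    qed
    then have "strict_mono (\<lambda>m. r (n + m)) \<and> mono (f \<circ> (\<lambda>m. r (n + m)))"
      using r(1) by (auto simp: strict_mono_def mono_def)
    then show ?thesis by blast
  qed (use r in blast)
qed

text \<open>The sequence form of Dickson's lemma: coordinates are treated one after another, and
  passing to a further subsequence keeps the earlier ones monotone.\<close>

lemma exists_mono_subseq_exponents:
  fixes f :: "nat \<Rightarrow> 'j \<Rightarrow> nat"
  assumes "finite J"
  shows "\<exists>r :: nat \<Rightarrow> nat. strict_mono r \<and> (\<forall>j\<in>J. mono (\<lambda>n. f (r n) j))"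
  using assms
proof (induction J rule: finite_induct)
  case empty
  show ?case by (rule exI[of _ id]) (simp add: strict_mono_def)
next
  case (insert j J)
  then obtain r :: "nat \<Rightarrow> nat" where r: "strict_mono r" "\<forall>j\<in>J. mono (\<lambda>n. f (r n) j)" by blast
  obtain s :: "nat \<Rightarrow> nat" where s: "strict_mono s" "mono (\<lambda>n. f (r (s n)) j)"
    using exists_mono_subseq_nat[of "\<lambda>n. f (r n) j"] by (auto simp: o_def)
  have "\<forall>j\<in>J. mono (\<lambda>n. f (r (s n)) j)"
    using r(2) s(1) by (auto simp: mono_def strict_mono_less_eq)
  then show ?case using r(1) s
    by (intro exI[of _ "r \<circ> s"]) (auto simp: strict_mono_def)
qed

text \<open>The ascending chain condition for monomial ideals. In a chain that never stabilises new
  elements keep entering; by Dickson's lemma a later one dominates an earlier one that is already in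
  the set, so it was not new.\<close>

lemma increasing_up_closed_stabilises:
  fixes U :: "nat \<Rightarrow> ('j \<Rightarrow> nat) set"
  assumes "finite J" "\<And>n. up_closed J (U n)" "mono U"
  shows "\<exists>N. \<forall>n\<ge>N. U n = U N"
proof (rule ccontr)
  assume "\<not> ?thesis"
  then have "\<forall>N. \<exists>n\<ge>N. U n \<noteq> U N" by auto
  then obtain g where g_ge: "g N \<ge> N" and "U (g N) \<noteq> U N" for N by metis
  then have "\<exists>c. c \<in> U (g N) - U N" for N using monoD[OF \<open>mono U\<close> g_ge[of N]] by blast
  then obtain f where f: "f N \<in> U (g N) - U N" for N by metis
  note g = g_ge f
  \<comment> \<open>Iterating \<open>g\<close> makes \<open>f (h k)\<close> an element of
    \<open>U (h (Suc k))\<close> that is missing from \<open>U (h k)\<close>.\<close>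
  define h where "h k = (g ^^ k) 0" for k
  have h: "h k \<le> h (k + m)" for k m
    by (induction m) (auto simp: h_def intro: order_trans[OF _ g(1)])
  obtain r :: "nat \<Rightarrow> nat" where r: "strict_mono r" "\<forall>j\<in>J. mono (\<lambda>n. f (h (r n)) j)"
    using exists_mono_subseq_exponents[OF assms(1), of "\<lambda>k. f (h k)"] by auto
  let ?a = "f (h (r 0))" and ?b = "f (h (r 1))"
  have "r 0 < r 1" using r(1) by (simp add: strict_mono_def)
  then have "g (h (r 0)) \<le> h (r 1)" using h[of "Suc (r 0)" "r 1 - Suc (r 0)"] by (simp add: h_def)
  then have a: "?a \<in> U (h (r 1))" using g(2)[of "h (r 0)"] \<open>mono U\<close> by (auto simp: mono_def)
  have "?a j \<le> ?b j" if "j \<in> J" for j using r(2) that monoD[of "\<lambda>n. f (h (r n)) j" 0 1] by auto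
  moreover have "?a j = 0" if "j \<notin> J" for j
    using a that assms(2) by (auto simp: up_closed_def exponents_def)
  ultimately have "?a \<le> ?b" by (metis le_funI le0)
  moreover have "?b \<in> exponents J" using g(2) assms(2) by (auto simp: up_closed_def)
  ultimately have "?b \<in> U (h (r 1))" using a assms(2) by (auto simp: up_closed_def)
  then show False using g(2) by auto
qed

lemma exponent_degree_fun_upd:
  assumes "finite J" "j \<notin> J"
  shows "exponent_degree w (insert j J) (c(j := n)) = exponent_degree w J c + n * w j"
proof -
  have "(\<Sum>i\<in>J. (c(j := n)) i * w i) = (\<Sum>i\<in>J. c i * w i)"
    using assms by (intro sum.cong) auto
  then show ?thesis using assms by (simp add: exponent_degree_def)
qed

text \<open>Induction on the number of variables. The slices by the exponent of \<open>j\<close>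
  increase with that exponent, so they are constant from some \<open>N\<close> on. The lower slices
  are finitely many and fall under the induction hypothesis; the rest consists of shifted copies of
  one slice, which contributes the factor \<open>1 - X^(w j)\<close>.\<close>

theorem hilbert_series_up_closed:
  assumes "finite J" "\<And>j. j \<in> J \<Longrightarrow> w j > 0" "up_closed J U"
  shows "rational_over (\<Prod>j\<in>J. 1 - fps_X ^ w j) (hilbert_series (exponent_degree w J) U)"
  using assms
proof (induction J arbitrary: U rule: finite_induct)
  case empty
  have fin: "finite U" using empty.prems(2)
    by (auto simp: up_closed_def exponents_def intro: finite_subset[of _ "{\<lambda>_. 0}"])
  have "hilbert_series (exponent_degree w {}) U = fps_of_poly [:of_nat (card U):]"
    by (rule fps_ext) (simp add: exponent_degree_def coeff_pCons split: nat.split)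
  then show ?case by (auto simp: rational_over_def)
next
  case (insert j J)
  let ?D = "\<Prod>j\<in>J. 1 - fps_X ^ w j :: complex fps"
  let ?deg = "exponent_degree w (insert j J)"
  \<comment> \<open>\<open>S n\<close> is the slice at exponent \<open>n\<close> with the coordinate
    \<open>j\<close> erased, a subset of \<open>exponents J\<close>; \<open>T n\<close> is the same
    slice placed back in \<open>U\<close>.\<close>
  define S where "S n = {c \<in> exponents J. c(j := n) \<in> U}" for n
  define T where "T n = (\<lambda>c. c(j := n)) ` S n" for n
  have up: "up_closed J (S n)" for n
    unfolding up_closed_def
  proof (intro conjI ballI impI)
    fix c c' assume c: "c \<in> S n" "c' \<in> exponents J" "c \<le> c'"
    then have "c(j := n) \<le> c'(j := n)" "c'(j := n) \<in> exponents (insert j J)"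
      by (auto simp: le_fun_def exponents_def)
    then show "c' \<in> S n" using c insert.prems(2) by (auto simp: S_def up_closed_def)
  qed (auto simp: S_def)
  have "mono S"
  proof (rule monoI, rule subsetI)
    fix m n c assume "m \<le> (n::nat)" "c \<in> S m"
    then have "c(j := m) \<le> c(j := n)" "c(j := n) \<in> exponents (insert j J)" "c(j := m) \<in> U"
      by (auto simp: S_def le_fun_def exponents_def)
    then show "c \<in> S n" using \<open>c \<in> S m\<close> insert.prems(2) by (auto simp: S_def up_closed_def)
  qed
  then obtain N where N: "\<And>n. n \<ge> N \<Longrightarrow> S n = S N"
    using increasing_up_closed_stabilises[of J S, OF insert.hyps(1) up] by blast
  have IH: "rational_over ?D (hilbert_series (exponent_degree w J) (S n))" for n
    using insert.prems(1) by (intro insert.IH up) auto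
  have hT: "hilbert_series ?deg ((\<lambda>c. c(j := n)) ` S m)
      = fps_X ^ (n * w j) * hilbert_series (exponent_degree w J) (S m)" for m n
  proof (rule hilbert_series_image)
    show "inj_on (\<lambda>c. c(j := n)) (S m)"
    proof (rule inj_onI)
      fix c c' assume *: "c \<in> S m" "c' \<in> S m" "c(j := n) = c'(j := n)"
      have "c i = c' i" for i
        using fun_cong[OF *(3), of i] *(1,2) insert.hyps(2)
        by (cases "i = j") (auto simp: S_def exponents_def)
      then show "c = c'" by auto
    qed
  qed (simp add: exponent_degree_fun_upd insert.hyps)
  have inU: "c(j := 0) \<in> S (c j)" if "c \<in> U" for c
    using that insert.prems(2) by (auto simp: S_def up_closed_def exponents_def)
  define R where "R = {c \<in> U. c j \<ge> N}"
  have fin: "finite {c \<in> A. ?deg c = d}" if "A \<subseteq> U" for A d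
    using that insert.prems
    by (intro finite_subset[OF _ finite_exponents_degree[of "insert j J" w d]])
       (auto simp: up_closed_def insert.hyps)
  have T_U: "T n \<subseteq> U" for n by (auto simp: T_def S_def)
  have T_eq: "T n = {c \<in> U. c j = n}" for n
  proof
    show "{c \<in> U. c j = n} \<subseteq> T n"
    proof
      fix c assume "c \<in> {c \<in> U. c j = n}"
      then show "c \<in> T n" using inU[of c]
        by (auto simp: T_def intro!: image_eqI[of _ _ "c(j := 0)"])
    qed
  qed (auto simp: T_def S_def)
  have U_eq: "U = (\<Union>n<N. T n) \<union> R" by (auto simp: T_eq R_def)
  have "hilbert_series ?deg U = hilbert_series ?deg (\<Union>n<N. T n) + hilbert_series ?deg R"
    by (subst U_eq, rule hilbert_series_Un; (rule fin)?) (auto simp: T_eq R_def)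
  also have "hilbert_series ?deg (\<Union>n<N. T n) = (\<Sum>n<N. hilbert_series ?deg (T n))"
    by (intro hilbert_series_UN fin T_U) (auto simp: disjoint_family_on_def T_eq)
  finally have hU: "hilbert_series ?deg U = (\<Sum>n<N. hilbert_series ?deg (T n)) + hilbert_series ?deg R" .
  \<comment> \<open>Multiplication by the variable \<open>j\<close>. As the slices agree from
    \<open>N\<close> on, it maps \<open>R\<close> onto \<open>R\<close> without its lowest slice
    \<open>T N\<close>.\<close>
  let ?f = "\<lambda>c. c(j := Suc (c j))"
  have fR: "?f ` R = {c \<in> U. c j > N}"
  proof
    show "?f ` R \<subseteq> {c \<in> U. c j > N}"
    proof
      fix c assume "c \<in> ?f ` R"
      then obtain c0 where c0: "c0 \<in> R" "c = ?f c0" by auto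
      then have "c0(j := 0) \<in> S (Suc (c0 j))" using inU[of c0] N[of "c0 j"] N[of "Suc (c0 j)"]
        by (auto simp: R_def)
      then show "c \<in> {c \<in> U. c j > N}" using c0 by (auto simp: S_def R_def)
    qed
    show "{c \<in> U. c j > N} \<subseteq> ?f ` R"
    proof
      fix c assume c: "c \<in> {c \<in> U. c j > N}"
      then have "c(j := 0) \<in> S (c j - 1)" using inU[of c] N[of "c j"] N[of "c j - 1"] by auto
      then have "c(j := c j - 1) \<in> R" using c by (auto simp: S_def R_def)
      then show "c \<in> ?f ` R" using c by (auto intro!: image_eqI[of _ _ "c(j := c j - 1)"])
    qed
  qed
  have R_eq: "R = {c \<in> U. c j > N} \<union> T N" by (auto simp: R_def T_eq)
  have hR: "hilbert_series ?deg R = hilbert_series ?deg (?f ` R) + hilbert_series ?deg (T N)"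
    unfolding fR by (subst R_eq, rule hilbert_series_Un; (rule fin)?) (auto simp: T_eq)
  have hfR: "hilbert_series ?deg (?f ` R) = fps_X ^ w j * hilbert_series ?deg R"
  proof (rule hilbert_series_image)
    show "inj_on ?f R"
    proof (rule inj_onI)
      fix c c' assume *: "?f c = ?f c'"
      have "c i = c' i" for i
        using fun_cong[OF *, of i] by (cases "i = j") auto
      then show "c = c'" by auto
    qed
    show "?deg (?f c) = ?deg c + w j" for c
      using exponent_degree_fun_upd[OF insert.hyps, of w c "Suc (c j)"]
        exponent_degree_fun_upd[OF insert.hyps, of w c "c j"] by simp
  qed
  \<comment> \<open>\<open>R\<close> is the disjoint union of its shift by degree \<open>w j\<close>
    and \<open>T N\<close>; this solves the resulting equation for the series of
    \<open>T N\<close>.\<close>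
  have "hilbert_series ?deg (T N) = hilbert_series ?deg R * (1 - fps_X ^ w j)"
    using hR unfolding hfR by (metis add_diff_cancel_left' mult.commute mult_1_right right_diff_distrib)
  moreover have rT: "rational_over ?D (hilbert_series ?deg (T n))" for n
    unfolding T_def hT by (intro rational_over_X_power_mult IH)
  ultimately have "rational_over ((1 - fps_X ^ w j) * ?D) (hilbert_series ?deg R)"
    using rT[of N] by (simp add: rational_over_def mult.assoc)
  moreover have "rational_over ((1 - fps_X ^ w j) * ?D) (\<Sum>n<N. hilbert_series ?deg (T n))"
    by (intro rational_over_sum rational_over_mult_denominator rT)
  ultimately show ?case
    unfolding hU using insert.hyps by (simp add: rational_over_add)
qed


text \<open>
  A graded set generated by finitely many elements under commuting shifts, in place of a graded
  module over a polynomial ring. Integer polynomials form a linearly ordered additive group, so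
  encoding a generator with its exponent vector as such a polynomial yields an additive total
  order on all presentations of an element. Non-minimal presentations stay non-minimal after a
  shift, hence the minimal ones form complements of up-closed sets.
\<close>

theorem hilbert_series_finitely_generated:
  fixes \<phi> :: "'i \<Rightarrow> ('j \<Rightarrow> nat) \<Rightarrow> 'b"
  assumes "finite F" "finite J" and w: "\<And>j. j \<in> J \<Longrightarrow> w j > 0"
    and compat: "\<And>i i' c c' m. \<lbrakk>i \<in> F; i' \<in> F; c \<in> exponents J; c' \<in> exponents J;
        m \<in> exponents J; \<phi> i c = \<phi> i' c'\<rbrakk> \<Longrightarrow> \<phi> i (\<lambda>j. c j + m j) = \<phi> i' (\<lambda>j. c' j + m j)"
    and deg: "\<And>i c. i \<in> F \<Longrightarrow> c \<in> exponents J \<Longrightarrow> deg (\<phi> i c) = e i + exponent_degree w J c"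
  shows "rational_over (\<Prod>j\<in>J. 1 - fps_X ^ w j) (hilbert_series deg (\<Union>i\<in>F. \<phi> i ` exponents J))"
proof -
  let ?D = "\<Prod>j\<in>J. 1 - fps_X ^ w j :: complex fps"
  let ?E = "exponents J" and ?ed = "exponent_degree w J"
  obtain \<iota> :: "'i \<Rightarrow> nat" where \<iota>: "inj_on \<iota> F"
    using finite_imp_inj_to_nat_seg[OF \<open>finite F\<close>] by blast
  obtain \<kappa> :: "'j \<Rightarrow> nat" where \<kappa>: "inj_on \<kappa> J"
    using finite_imp_inj_to_nat_seg[OF \<open>finite J\<close>] by blast
  \<comment> \<open>Coefficient 0 is reserved for the index of the generator, hence
    \<open>Suc\<close>; a key can therefore be decoded into both of its parts.\<close>
  define ekey where "ekey c = (\<Sum>j\<in>J. monom (int (c j)) (Suc (\<kappa> j)))" for c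
  define key where "key i c = monom (int (\<iota> i)) 0 + ekey c" for i c
  have coeff_ekey: "coeff (ekey c) (Suc (\<kappa> j)) = int (c j)" if "j \<in> J" for c j
  proof -
    have "coeff (ekey c) (Suc (\<kappa> j)) = (\<Sum>i\<in>J. if i = j then int (c j) else 0)"
      unfolding ekey_def coeff_sum using that \<kappa> by (intro sum.cong) (auto simp: inj_on_def)
    then show ?thesis using that \<open>finite J\<close> by simp
  qed
  have coeff_0: "coeff (ekey c) 0 = 0" for c
    by (simp add: ekey_def coeff_sum)
  have key_inj: "i = i' \<and> c = c'"
    if "key i c = key i' c'" "i \<in> F" "i' \<in> F" "c \<in> ?E" "c' \<in> ?E" for i i' c c'
  proof -
    have *: "coeff (key i c) n = coeff (key i' c') n" for n using that(1) by simp
    have "c j = c' j" for j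
      using that(4,5) *[of "Suc (\<kappa> j)"]
      by (cases "j \<in> J") (auto simp: key_def coeff_ekey exponents_def)
    moreover have "\<iota> i = \<iota> i'" using *[of 0] by (simp add: key_def coeff_0)
    ultimately show ?thesis using \<iota> that by (auto simp: inj_on_def)
  qed
  have key_add: "key i (\<lambda>j. c j + m j) = key i c + ekey m" for i c m
    by (simp add: key_def ekey_def sum.distrib[symmetric] add_monom)
  define smaller where "smaller i c i' c' \<longleftrightarrow>
    i' \<in> F \<and> c' \<in> ?E \<and> \<phi> i' c' = \<phi> i c \<and> key i' c' < key i c" for i c i' c'
  define U where "U i = {c \<in> ?E. \<exists>i' c'. smaller i c i' c'}" for i
  have up: "up_closed J (U i)" if i: "i \<in> F" for i
    unfolding up_closed_def
  proof (intro conjI ballI impI)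
    fix c d assume c: "c \<in> U i" and d: "d \<in> ?E" "c \<le> d"
    from c obtain i' c' where s: "c \<in> ?E" "i' \<in> F" "c' \<in> ?E" "\<phi> i' c' = \<phi> i c" "key i' c' < key i c"
      by (auto simp: U_def smaller_def)
    define m where "m j = d j - c j" for j
    have d_eq: "d = (\<lambda>j. c j + m j)" using d(2) by (auto simp: m_def le_fun_def)
    have m: "m \<in> ?E" using d(1) by (auto simp: exponents_def m_def)
    have "\<phi> i' (\<lambda>j. c' j + m j) = \<phi> i d" unfolding d_eq using s m i by (intro compat) auto
    moreover have "key i' (\<lambda>j. c' j + m j) < key i d" unfolding d_eq key_add using s by simp
    moreover have "(\<lambda>j. c' j + m j) \<in> ?E" using s m by (auto simp: exponents_def)
    ultimately show "d \<in> U i" using d s by (auto simp: U_def smaller_def)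
  qed (auto simp: U_def)
  define C where "C i = ?E - U i" for i
  have C_le: "key i c \<le> key i' c'"
    if "c \<in> C i" "i' \<in> F" "c' \<in> ?E" "\<phi> i c = \<phi> i' c'" for i c i' c'
    using that unfolding C_def U_def smaller_def not_less[symmetric] by auto
  have C_unique: "i = i' \<and> c = c'"
    if "i \<in> F" "i' \<in> F" "c \<in> C i" "c' \<in> C i'" "\<phi> i c = \<phi> i' c'" for i c i' c'
  proof (rule key_inj)
    show "c \<in> ?E" "c' \<in> ?E" using that by (auto simp: C_def)
    then show "key i c = key i' c'" using that by (intro antisym C_le) auto
  qed fact+
  have cover: "(\<Union>i\<in>F. \<phi> i ` ?E) = (\<Union>i\<in>F. \<phi> i ` C i)"
  proof
    show "(\<Union>i\<in>F. \<phi> i ` ?E) \<subseteq> (\<Union>i\<in>F. \<phi> i ` C i)"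
    proof
      fix b assume "b \<in> (\<Union>i\<in>F. \<phi> i ` ?E)"
      define R where "R = {(i, c). i \<in> F \<and> c \<in> ?E \<and> \<phi> i c = b}"
      have "R \<noteq> {}" using \<open>b \<in> _\<close> by (auto simp: R_def)
      \<comment> \<open>The degree of \<open>b\<close> determines the degree of the exponent vector
        for each generator, so \<open>b\<close> has finitely many presentations and one of them has
        the least key.\<close>
      have "R \<subseteq> (SIGMA i:F. {c \<in> ?E. ?ed c = deg b - e i})" by (auto simp: R_def deg)
      then have "finite R" using \<open>finite F\<close> finite_exponents_degree[OF \<open>finite J\<close> w]
        by (rule_tac finite_subset) auto
      let ?K = "(\<lambda>(i, c). key i c) ` R"
      have "Min ?K \<in> ?K" using \<open>R \<noteq> {}\<close> \<open>finite R\<close> by (intro Min_in) auto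
      then obtain i c where ic: "(i, c) \<in> R" "key i c = Min ?K" by auto
      have "\<not> smaller i c i' c'" for i' c'
      proof
        assume "smaller i c i' c'"
        then have "(i', c') \<in> R" "key i' c' < key i c" using ic by (auto simp: smaller_def R_def)
        moreover have "key i c \<le> key i' c'"
          unfolding ic(2) using \<open>(i', c') \<in> R\<close> \<open>finite R\<close> by (intro Min_le) force+
        ultimately show False by simp
      qed
      then have "c \<in> C i" using ic by (auto simp: C_def U_def R_def)
      then show "b \<in> (\<Union>i\<in>F. \<phi> i ` C i)" using ic by (auto simp: R_def)
    qed
  qed (auto simp: C_def)
  have fin: "finite {c \<in> A. ?ed c = d}" if "A \<subseteq> ?E" for A d
    by (rule finite_subset[OF _ finite_exponents_degree[of J w d]]) (use that \<open>finite J\<close> w in auto)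
  have hE: "rational_over ?D (hilbert_series ?ed ?E)"
    using \<open>finite J\<close> w by (intro hilbert_series_up_closed) (auto simp: up_closed_def)
  have hC: "rational_over ?D (hilbert_series ?ed (C i))" if "i \<in> F" for i
  proof -
    have UE: "U i \<subseteq> ?E" by (auto simp: U_def)
    then have "?E = C i \<union> U i" by (auto simp: C_def)
    moreover have "hilbert_series ?ed (C i \<union> U i) = hilbert_series ?ed (C i) + hilbert_series ?ed (U i)"
      using UE by (intro hilbert_series_Un fin) (auto simp: C_def)
    ultimately have "hilbert_series ?ed (C i) = hilbert_series ?ed ?E - hilbert_series ?ed (U i)"
      by simp
    then show ?thesis
      using rational_over_diff[OF hE hilbert_series_up_closed[OF \<open>finite J\<close> w up[OF that]]] by simp
  qed
  have img: "hilbert_series deg (\<phi> i ` C i) = fps_X ^ e i * hilbert_series ?ed (C i)" if "i \<in> F" for i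
    by (rule hilbert_series_image) (use C_unique that deg in \<open>auto simp: inj_on_def C_def\<close>)
  have "hilbert_series deg (\<Union>i\<in>F. \<phi> i ` C i) = (\<Sum>i\<in>F. hilbert_series deg (\<phi> i ` C i))"
  proof (rule hilbert_series_UN)
    show "disjoint_family_on (\<lambda>i. \<phi> i ` C i) F"
      unfolding disjoint_family_on_def using C_unique by blast
    fix i d assume i: "i \<in> F"
    have "{a \<in> \<phi> i ` C i. deg a = d} \<subseteq> \<phi> i ` {c \<in> C i. ?ed c = d - e i}"
      using i deg by (auto simp: C_def)
    then show "finite {a \<in> \<phi> i ` C i. deg a = d}"
      by (rule finite_subset) (intro finite_imageI fin, auto simp: C_def)
  qed fact
  then show ?thesis unfolding cover
    by (simp add: img) (intro rational_over_sum rational_over_X_power_mult hC)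
qed

section \<open>Quasi-polynomials and lattices\<close>

text \<open>The difference of \<open>x^(k+1)\<close> has leading term \<open>(k+1) a x^k\<close>;
  its lower terms are cancelled by the antidifferences of lower powers.\<close>

lemma power_antidifference:
  fixes a :: complex
  assumes "a \<noteq> 0"
  shows "\<exists>R. \<forall>x. poly R x - poly R (x - a) = x ^ k"
proof (induction k rule: less_induct)
  case (less k)
  then obtain R where R: "i < k \<Longrightarrow> poly (R i) x - poly (R i) (x - a) = x ^ i" for i x
    by metis
  \<comment> \<open>The \<open>\<beta> i\<close> are the coefficients of
    \<open>(x - a)^(k+1)\<close> below degree \<open>k\<close>, and \<open>s\<close> normalises the
    term of degree \<open>k\<close>.\<close>
  define \<beta> where "\<beta> i = of_nat (Suc k choose i) * (- a) ^ (Suc k - i)" for i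
  define s where "s = 1 / (of_nat (Suc k) * a)"
  define T where "T = smult s (monom 1 (Suc k) + (\<Sum>i<k. smult (\<beta> i) (R i)))"
  have "poly T x - poly T (x - a) = x ^ k" for x
  proof -
    have "(x - a) ^ Suc k = (\<Sum>i\<le>Suc k. of_nat (Suc k choose i) * x ^ i * (- a) ^ (Suc k - i))"
      using binomial_ring[of x "- a" "Suc k"] by simp
    also have "\<dots> = (\<Sum>i<k. \<beta> i * x ^ i) - of_nat (Suc k) * a * x ^ k + x ^ Suc k"
    proof -
      have "Suc k choose k = Suc k" using binomial_symmetric[of k "Suc k"] by simp
      then show ?thesis
        by (simp add: lessThan_Suc_atMost[symmetric] \<beta>_def mult_ac del: power_Suc binomial_Suc_Suc)
    qed
    finally have pow: "x ^ Suc k - (x - a) ^ Suc k + (\<Sum>i<k. \<beta> i * x ^ i) = of_nat (Suc k) * a * x ^ k"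
      by simp
    have "poly T x - poly T (x - a) = s * (x ^ Suc k - (x - a) ^ Suc k
        + (\<Sum>i<k. \<beta> i * (poly (R i) x - poly (R i) (x - a))))"
      by (simp add: T_def poly_monom poly_sum algebra_simps sum_subtractf)
    also have "\<dots> = s * (of_nat (Suc k) * a * x ^ k)"
    proof -
      have "(\<Sum>i<k. \<beta> i * (poly (R i) x - poly (R i) (x - a))) = (\<Sum>i<k. \<beta> i * x ^ i)"
        by (intro sum.cong) (simp_all add: R)
      then show ?thesis by (simp only: pow)
    qed
    also have "\<dots> = x ^ k" using assms by (simp add: s_def del: of_nat_Suc)
    finally show ?thesis .
  qed
  then show ?case by blast
qed

lemma poly_antidifference:
  fixes a :: complex
  assumes "a \<noteq> 0"
  shows "\<exists>R. \<forall>x. poly R x - poly R (x - a) = poly Q x"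
proof -
  obtain R where R: "poly (R k) x - poly (R k) (x - a) = x ^ k" for k x
    using power_antidifference[OF assms] by metis
  have "poly (\<Sum>i\<le>degree Q. smult (coeff Q i) (R i)) x - poly (\<Sum>i\<le>degree Q. smult (coeff Q i) (R i)) (x - a)
      = (\<Sum>i\<le>degree Q. coeff Q i * (poly (R i) x - poly (R i) (x - a)))" for x
    by (simp add: poly_sum sum_subtractf right_diff_distrib)
  then show ?thesis unfolding R poly_altdef[symmetric] by blast
qed

text \<open>Induction on \<open>k\<close>: removing one factor \<open>1 - X^N\<close> means summing
  coefficients along residue classes mod \<open>N\<close>, and on each class an antidifference with
  step \<open>N\<close> performs this summation by a polynomial.\<close>

lemma has_quasi_period_rational:
  fixes H :: "complex fps"
  assumes "N > 0" "H * (1 - fps_X ^ N) ^ k = fps_of_poly P"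
  shows "has_quasi_period (fps_nth H) N"
  using assms(2)
proof (induction k arbitrary: H)
  case 0
  have "\<forall>\<^sub>F m in sequentially. fps_nth H m = 0"
    using eventually_gt_at_top[of "degree P"]
    by eventually_elim (use 0 in \<open>simp add: coeff_eq_0\<close>)
  then show ?case using assms(1) unfolding has_quasi_period_def
    by (intro conjI exI[of _ "\<lambda>_. 0"] allI impI) (auto elim: eventually_mono)
next
  case (Suc k)
  define H' where "H' = H * (1 - fps_X ^ N)"
  have H': "fps_nth H' m = fps_nth H m - (if m < N then 0 else fps_nth H (m - N))" for m
    by (simp add: H'_def right_diff_distrib fps_X_power_mult_right_nth)
  have "H' * (1 - fps_X ^ N) ^ k = fps_of_poly P" using Suc.prems by (simp add: H'_def mult_ac)
  from Suc.IH[OF this] obtain Q where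
    Q: "j < N \<Longrightarrow> \<forall>\<^sub>F m in sequentially. m mod N = j \<longrightarrow> fps_nth H' m = poly (Q j) (of_nat m)" for j
    by (auto simp: has_quasi_period_def)
  have "\<exists>R. \<forall>\<^sub>F m in sequentially. m mod N = j \<longrightarrow> fps_nth H m = poly R (of_nat m)" if j: "j < N" for j
  proof -
    obtain M where M: "\<And>m. m \<ge> M \<Longrightarrow> m mod N = j \<Longrightarrow> fps_nth H' m = poly (Q j) (of_nat m)"
      using Q[OF j] by (auto simp: eventually_sequentially)
    obtain R where R: "poly R x - poly R (x - of_nat N) = poly (Q j) x" for x
      using poly_antidifference[of "of_nat N" "Q j"] assms(1) by auto
    \<comment> \<open>A starting index in the class of \<open>j\<close> beyond which the formula for
      \<open>H'\<close> is valid.\<close>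
    define m0 where "m0 = j + N * M"
    have m0: "m0 \<ge> M" "m0 mod N = j" using assms(1) j by (auto simp: m0_def trans_le_add2)
    \<comment> \<open>The constant of summation, fixed by the value at \<open>m0\<close>.\<close>
    define C where "C = fps_nth H m0 - poly R (of_nat m0)"
    have step: "fps_nth H (m0 + N * i) = poly (R + [:C:]) (of_nat (m0 + N * i))" for i
    proof (induction i)
      case 0
      show ?case by (simp add: C_def)
    next
      case (Suc i)
      let ?m = "m0 + N * Suc i"
      have m: "?m - N = m0 + N * i" "\<not> ?m < N" by auto
      have "?m mod N = j" using m0(2) by (simp only: mod_mult_self2)
      then have "fps_nth H' ?m = poly (Q j) (of_nat ?m)" using M[of ?m] m0(1) by simp
      then have "fps_nth H ?m = fps_nth H (m0 + N * i) + poly (Q j) (of_nat ?m)"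
        unfolding H' m(1) using m(2) by (simp add: algebra_simps)
      also have "\<dots> = poly (R + [:C:]) (of_nat ?m)"
        unfolding Suc R[symmetric] by (simp add: algebra_simps)
      finally show ?case .
    qed
    have "fps_nth H m = poly (R + [:C:]) (of_nat m)" if "m \<ge> m0" "m mod N = j" for m
    proof -
      have "N dvd m - m0" using that m0(2) mod_eq_dvd_iff_nat[of m0 m N] by simp
      then obtain i where "m - m0 = N * i" by (rule dvdE)
      then have "m = m0 + N * i" using that(1) by simp
      then show ?thesis using step by simp
    qed
    then show ?thesis unfolding eventually_sequentially by (intro exI[of _ "R + [:C:]"]) blast
  qed
  then obtain R where "\<forall>j<N. \<forall>\<^sub>F m in sequentially. m mod N = j \<longrightarrow> fps_nth H m = poly (R j) (of_nat m)"
    by metis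
  then show ?case using assms(1) by (auto simp: has_quasi_period_def)
qed

text \<open>Each \<open>1 - X^(w v)\<close> divides \<open>1 - X^N\<close> with a geometric sum as
  quotient, so the denominator can be enlarged to a power of \<open>1 - X^N\<close>.\<close>

lemma has_quasi_period_prod:
  fixes H :: "complex fps"
  assumes "N > 0" "\<And>v. v \<in> S \<Longrightarrow> w v dvd N"
    and "H * (\<Prod>v\<in>S. 1 - fps_X ^ w v) = fps_of_poly P"
  shows "has_quasi_period (fps_nth H) N"
proof -
  have "\<exists>R. 1 - fps_X ^ N = (1 - fps_X ^ w v :: complex fps) * fps_of_poly R" if v: "v \<in> S" for v
  proof -
    obtain k where "N = w v * k" using assms(2)[OF v] by (rule dvdE)
    then have "1 - fps_X ^ N = (1 - fps_X ^ w v) * (\<Sum>i<k. (fps_X ^ w v) ^ i :: complex fps)"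
      by (simp add: power_mult one_diff_power_eq)
    also have "(\<Sum>i<k. (fps_X ^ w v) ^ i :: complex fps) = fps_of_poly (\<Sum>i<k. (monom 1 (w v)) ^ i)"
      by (simp add: fps_of_poly_sum fps_of_poly_power fps_of_poly_monom')
    finally show ?thesis by (rule exI)
  qed
  then obtain R where R: "v \<in> S \<Longrightarrow> 1 - fps_X ^ N = (1 - fps_X ^ w v :: complex fps) * fps_of_poly (R v)" for v
    by metis
  have "(1 - fps_X ^ N) ^ card S = (\<Prod>v\<in>S. (1 - fps_X ^ w v) * fps_of_poly (R v))"
    unfolding prod_constant[symmetric] by (intro prod.cong refl R)
  then have "H * (1 - fps_X ^ N) ^ card S = fps_of_poly (P * (\<Prod>v\<in>S. R v))"
    by (simp add: prod.distrib fps_of_poly_mult fps_of_poly_prod assms(3)[symmetric] mult_ac)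
  then show ?thesis by (rule has_quasi_period_rational[OF assms(1)])
qed

text \<open>The coordinate functionals of a basis are linear, hence bounded, so points of the ball
  have integer coordinates in a finite box.\<close>

lemma finite_lattice_cball:
  fixes L :: "'l::euclidean_space set"
  assumes "lattice_of_rank n L"
  shows "finite (L \<inter> cball 0 r)"
proof -
  obtain B where B: "independent B" and L: "L = {\<Sum>b\<in>B. real_of_int (c b) *\<^sub>R b | c. True}"
    using assms by (auto simp: lattice_of_rank_def)
  have "finite B" using B by (rule independent_imp_finite)
  have "\<exists>f :: 'l \<Rightarrow> real. linear f \<and> (\<forall>x\<in>B. f x = (if x = b then 1 else 0))" for b
    using linear_independent_extend[OF B, of "\<lambda>x. if x = b then 1 else 0"] by auto
  then obtain f :: "'l \<Rightarrow> 'l \<Rightarrow> real" where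
    f: "linear (f b)" "x \<in> B \<Longrightarrow> f b x = (if x = b then 1 else 0)" for b x by metis
  have "\<exists>K. \<forall>x. norm (f b x) \<le> K * norm x" for b using linear_bounded[OF f(1)] by blast
  then obtain K where K: "\<bar>f b x\<bar> \<le> K b * norm x" for b x by (auto simp: real_norm_def) metis
  let ?C = "PiE B (\<lambda>b. {- \<lceil>\<bar>K b\<bar> * r\<rceil> .. \<lceil>\<bar>K b\<bar> * r\<rceil>})"
  have "L \<inter> cball 0 r \<subseteq> (\<lambda>c. \<Sum>b\<in>B. real_of_int (c b) *\<^sub>R b) ` ?C"
  proof
    fix x assume x: "x \<in> L \<inter> cball 0 r"
    then obtain c where c: "x = (\<Sum>b\<in>B. real_of_int (c b) *\<^sub>R b)" by (auto simp: L)
    have "\<bar>c b\<bar> \<le> \<lceil>\<bar>K b\<bar> * r\<rceil>" if b: "b \<in> B" for b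
    proof -
      have "f b x = (\<Sum>b'\<in>B. real_of_int (c b') * f b b')"
        unfolding c using f(1) by (simp add: linear_sum linear_cmul)
      also have "\<dots> = (\<Sum>b'\<in>B. if b' = b then real_of_int (c b') else 0)"
        by (intro sum.cong) (auto simp: f(2))
      also have "\<dots> = real_of_int (c b)" using b \<open>finite B\<close> by simp
      finally have "real_of_int \<bar>c b\<bar> \<le> K b * norm x" using K[of b x] by simp
      also have "\<dots> \<le> \<bar>K b\<bar> * r" using x by (intro mult_mono) auto
      finally show ?thesis by linarith
    qed
    then have "restrict c B \<in> ?C" by (auto simp: abs_le_iff) (smt (verit))+
    moreover have "x = (\<Sum>b\<in>B. real_of_int (restrict c B b) *\<^sub>R b)" by (simp add: c)
    ultimately show "x \<in> (\<lambda>c. \<Sum>b\<in>B. real_of_int (c b) *\<^sub>R b) ` ?C" by blast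
  qed
  moreover have "finite ?C" using \<open>finite B\<close> by (intro finite_PiE) auto
  ultimately show ?thesis by (auto intro: finite_subset)
qed

lemma lattice_of_rank_int_combination:
  assumes "lattice_of_rank n L" "\<And>j. j \<in> J \<Longrightarrow> g j \<in> L"
  shows "(\<Sum>j\<in>J. real_of_int (z j) *\<^sub>R g j) \<in> L"
proof -
  have "real_of_int k *\<^sub>R a \<in> L" if a: "a \<in> L" for k a
  proof -
    obtain B where L: "L = {\<Sum>b\<in>B. real_of_int (c b) *\<^sub>R b | c. True}"
      using assms(1) by (auto simp: lattice_of_rank_def)
    obtain c where "a = (\<Sum>b\<in>B. real_of_int (c b) *\<^sub>R b)" using a L by auto
    then have "real_of_int k *\<^sub>R a = (\<Sum>b\<in>B. real_of_int (k * c b) *\<^sub>R b)"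
      by (simp add: scaleR_sum_right)
    then show ?thesis unfolding L by (intro CollectI exI[of _ "\<lambda>b. k * c b"]) simp
  qed
  then show ?thesis using assms(2) lattice_of_rank_closed[OF assms(1)]
    by (induction J rule: infinite_finite_induct) auto
qed

text \<open>
  The remainders of the multiples of \<open>a\<close> after rounding the coefficients down are lattice points in
  a bounded region, so two of them coincide; the difference of the two multiples is the one sought.
\<close>

lemma lattice_cone_multiple:
  fixes L :: "'l::euclidean_space set"
  assumes L: "lattice_of_rank n L" and "finite J" and g: "\<And>j. j \<in> J \<Longrightarrow> g j \<in> L"
    and u: "\<And>j. j \<in> J \<Longrightarrow> u j \<ge> 0"
    and a: "a \<in> L" "a = (\<Sum>j\<in>J. u j *\<^sub>R g j)"
    and d: "real d = (\<Sum>j\<in>J. u j * real (w j))"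
  shows "\<exists>k>0. \<exists>m. real k *\<^sub>R a = (\<Sum>j\<in>J. real (m j) *\<^sub>R g j) \<and> k * d = (\<Sum>j\<in>J. m j * w j)"
proof -
  define r where "r k = (\<Sum>j\<in>J. frac (real k * u j) *\<^sub>R g j)" for k
  \<comment> \<open>The weights are rounded with the same coefficients, so one coincidence of pairs
    settles the equation for \<open>a\<close> and the one for \<open>d\<close> at once.
    \<open>s k\<close> is an integer because it differs from \<open>k * d\<close> by one.\<close>
  define s where "s k = (\<Sum>j\<in>J. frac (real k * u j) * real (w j))" for k
  have r_eq: "r k = real k *\<^sub>R a - (\<Sum>j\<in>J. real_of_int \<lfloor>real k * u j\<rfloor> *\<^sub>R g j)" for k
    by (simp add: r_def frac_def a(2) scaleR_sum_right sum_subtractf scaleR_diff_left)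
  have s_eq: "s k = real k * real d - (\<Sum>j\<in>J. real_of_int \<lfloor>real k * u j\<rfloor> * real (w j))" for k
    by (simp add: s_def frac_def d sum_distrib_left sum_subtractf algebra_simps)
  have frac: "0 \<le> frac x" "frac x \<le> 1" for x :: real using frac_lt_1[of x] by auto
  have "range (\<lambda>k. (r k, s k)) \<subseteq> (L \<inter> cball 0 (\<Sum>j\<in>J. norm (g j))) \<times> real_of_int ` {0..(\<Sum>j\<in>J. int (w j))}"
  proof safe
    fix k :: nat
    have "real k *\<^sub>R a \<in> L" using lattice_of_rank_int_combination[OF L, of "{()}" "\<lambda>_. a" "\<lambda>_. int k"] a by simp
    then show "r k \<in> L" unfolding r_eq
      by (intro lattice_of_rank_closed[OF L] lattice_of_rank_int_combination[OF L] g) auto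
    have "norm (r k) \<le> (\<Sum>j\<in>J. norm (g j))"
      unfolding r_def using frac by (intro order_trans[OF norm_sum] sum_mono) (auto intro!: mult_left_le_one_le)
    then show "r k \<in> cball 0 (\<Sum>j\<in>J. norm (g j))" by simp
    let ?z = "int k * int d - (\<Sum>j\<in>J. \<lfloor>real k * u j\<rfloor> * int (w j))"
    have z: "s k = real_of_int ?z" by (simp add: s_eq)
    have "s k \<ge> 0" unfolding s_def using frac by (intro sum_nonneg) auto
    then have "?z \<ge> 0" unfolding z by (simp only: of_int_0_le_iff)
    moreover have "s k \<le> (\<Sum>j\<in>J. real (w j))"
      unfolding s_def using frac by (intro sum_mono) (auto intro!: mult_left_le_one_le)
    then have "real_of_int ?z \<le> real_of_int (\<Sum>j\<in>J. int (w j))" unfolding z by simp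
    then have "?z \<le> (\<Sum>j\<in>J. int (w j))" by (simp only: of_int_le_iff)
    with z \<open>?z \<ge> 0\<close> show "s k \<in> real_of_int ` {0..(\<Sum>j\<in>J. int (w j))}"
      by (intro image_eqI[of _ _ ?z]) auto
  qed
  then have "finite (range (\<lambda>k. (r k, s k)))"
    by (rule finite_subset) (auto intro: finite_lattice_cball[OF L])
  then have "\<not> inj (\<lambda>k. (r k, s k))" using finite_imageD infinite_UNIV_nat by blast
  then obtain k l where kl: "k < l" "r k = r l" "s k = s l"
    unfolding inj_def by (metis linorder_neqE_nat prod.inject)
  \<comment> \<open>Nonnegative on \<open>J\<close>, since \<open>u j \<ge> 0\<close> and
    \<open>k < l\<close>; the conversion by \<open>nat\<close> therefore loses nothing.\<close>
  define z where "z j = \<lfloor>real l * u j\<rfloor> - \<lfloor>real k * u j\<rfloor>" for j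
  have z: "real (nat (z j)) = real_of_int \<lfloor>real l * u j\<rfloor> - real_of_int \<lfloor>real k * u j\<rfloor>" if "j \<in> J" for j
  proof -
    have "\<lfloor>real k * u j\<rfloor> \<le> \<lfloor>real l * u j\<rfloor>"
      using u[OF that] kl(1) by (intro floor_mono mult_right_mono) auto
    then show ?thesis by (simp add: z_def)
  qed
  have "real (l - k) *\<^sub>R a = (\<Sum>j\<in>J. real (nat (z j)) *\<^sub>R g j)"
    using kl(1,2) unfolding r_eq
    by (simp add: z scaleR_diff_left sum_subtractf of_nat_diff algebra_simps cong: sum.cong)
  moreover have "real ((l - k) * d) = real (\<Sum>j\<in>J. nat (z j) * w j)"
    using kl(1,3) unfolding s_eq
    by (simp add: z left_diff_distrib sum_subtractf of_nat_diff algebra_simps cong: sum.cong)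
  then have "(l - k) * d = (\<Sum>j\<in>J. nat (z j) * w j)" by (simp only: of_nat_eq_iff)
  ultimately show ?thesis using kl(1) by (intro exI[of _ "l - k"]) (auto intro!: exI[of _ "\<lambda>j. nat (z j)"])
qed

section \<open>Walks and cycles in finite digraphs\<close>

context wf_digraph
begin

text \<open>Splicing a closed walk in at \<open>x\<close> adds its label and keeps every visited
  vertex, \<open>x\<close> among them, so it can be repeated.\<close>

lemma insert_closed_walk_power:
  fixes lab :: "'b \<Rightarrow> 'z::real_vector"
  assumes "awalk u p v" "awalk x z x" "x \<in> set (awalk_verts u p)"
  shows "\<exists>p'. awalk u p' v \<and> set (awalk_verts u p) \<subseteq> set (awalk_verts u p') \<and>
    sum_list (map lab p') = sum_list (map lab p) + real k *\<^sub>R sum_list (map lab z)"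
  using assms(1,3)
proof (induction k arbitrary: p)
  case 0
  then show ?case by auto
next
  case (Suc k)
  obtain q r where qr: "p = q @ r" "awalk u q x" "awalk x r v"
    using awalk_decomp[OF Suc.prems] by blast
  let ?p = "q @ z @ r"
  have zr: "awalk x (z @ r) v" by (rule awalk_appendI[OF assms(2) qr(3)])
  have p: "awalk u ?p v" by (rule awalk_appendI[OF qr(2) zr])
  have sub: "set (awalk_verts u p) \<subseteq> set (awalk_verts u ?p)"
    unfolding qr(1) set_awalk_verts_append[OF qr(2) zr] set_awalk_verts_append[OF assms(2) qr(3)]
      set_awalk_verts_append[OF qr(2,3)] by blast
  have "x \<in> set (awalk_verts u ?p)" using sub Suc.prems(2) by blast
  from Suc.IH[OF p this] obtain p' where
    "awalk u p' v" "set (awalk_verts u ?p) \<subseteq> set (awalk_verts u p')"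
    "sum_list (map lab p') = sum_list (map lab ?p) + real k *\<^sub>R sum_list (map lab z)" by blast
  then show ?case using sub
    by (intro exI[of _ p']) (auto simp: qr(1) scaleR_add_left add_ac)
qed

text \<open>As insertions only add vertices, each closed walk still meets the current walk when its
  turn comes.\<close>

lemma insert_closed_walks:
  fixes lab :: "'b \<Rightarrow> 'z::real_vector"
  assumes "finite I" "awalk u p v"
    and "\<And>i. i \<in> I \<Longrightarrow> k i > 0 \<Longrightarrow> \<exists>x\<in>set (awalk_verts u p). awalk x (z i) x"
  shows "\<exists>p'. awalk u p' v \<and> set (awalk_verts u p) \<subseteq> set (awalk_verts u p') \<and>
    sum_list (map lab p') = sum_list (map lab p) + (\<Sum>i\<in>I. real (k i) *\<^sub>R sum_list (map lab (z i)))"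
  using assms
proof (induction I rule: finite_induct)
  case empty
  then show ?case by auto
next
  case (insert i I)
  from insert.IH[OF insert.prems(1)] insert.prems(2) obtain p' where p': "awalk u p' v"
    "set (awalk_verts u p) \<subseteq> set (awalk_verts u p')"
    "sum_list (map lab p') = sum_list (map lab p) + (\<Sum>i\<in>I. real (k i) *\<^sub>R sum_list (map lab (z i)))"
    by auto
  show ?case
  proof (cases "k i = 0")
    case True
    then show ?thesis using p' insert.hyps by auto
  next
    case False
    then obtain x where x: "x \<in> set (awalk_verts u p')" "awalk x (z i) x"
      using insert.prems(2)[of i] p'(2) by auto
    from insert_closed_walk_power[OF p'(1) x(2,1), of lab "k i"] obtain p'' where
      "awalk u p'' v" "set (awalk_verts u p') \<subseteq> set (awalk_verts u p'')"
      "sum_list (map lab p'') = sum_list (map lab p') + real (k i) *\<^sub>R sum_list (map lab (z i))"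
      by blast
    then show ?thesis using p' insert.hyps by (intro exI[of _ p'']) (auto simp: add_ac)
  qed
qed

text \<open>Cut the cycle at \<open>x\<close> and swap the two pieces; the label sum is unchanged
  because addition commutes.\<close>

lemma cycle_rotate:
  fixes lab :: "'b \<Rightarrow> 'z::comm_monoid_add"
  assumes "cycle c" "x \<in> walk_supp G c"
  shows "\<exists>z. awalk x z x \<and> sum_list (map lab z) = sum_list (map lab c)"
proof -
  obtain u where u: "awalk u c u" "c \<noteq> []" using assms(1) by (auto simp: cycle_def)
  have "x \<in> set (awalk_verts u c)"
    using assms(2) u by (auto simp: walk_supp_def set_awalk_verts)
  then obtain q r where "c = q @ r" "awalk u q x" "awalk x r u" using awalk_decomp[OF u(1)] by blast
  then show ?thesis by (intro exI[of _ "r @ q"] conjI awalk_appendI) (auto simp: add.commute)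
qed

end

context fin_digraph
begin

text \<open>The arcs of a cycle have distinct heads. This makes the cycles finite in number and
  bounds their weights in the unweighted case.\<close>

lemma length_cycle_le:
  assumes "cycle c"
  shows "length c \<le> card (verts G)"
proof -
  obtain u where u: "awalk u c u" "distinct (tl (awalk_verts u c))" using assms by (auto simp: cycle_def)
  have "length c = card (set (tl (awalk_verts u c)))"
    using distinct_card[OF u(2)] by (simp add: length_awalk_verts)
  also have "\<dots> \<le> card (verts G)"
  proof (rule card_mono)
    show "set (tl (awalk_verts u c)) \<subseteq> verts G"
      using u(1) list.set_sel(2)[of "awalk_verts u c"] by (auto elim!: awalkE')
  qed simp
  finally show ?thesis .
qed

lemma finite_cycles: "finite {c. cycle c}"
proof (rule finite_subset)
  show "{c. cycle c} \<subseteq> {c. set c \<subseteq> arcs G \<and> length c \<le> card (verts G)}"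
    using length_cycle_le by (auto simp: cycle_def)
qed (simp add: finite_lists_length_le)

text \<open>
  The remaining walk is kept in the form \<open>r @ s\<close>, where \<open>r\<close> already visits every vertex of \<open>p\<close> and \<open>s\<close>
  is a path. A newly visited vertex moves \<open>s\<close> into \<open>r\<close>, which bounds the length of \<open>r\<close>; returning to a
  vertex of \<open>s\<close> splits off a cycle without losing any visited vertex.
\<close>

lemma walk_decomposition_aux:
  fixes lab :: "'b \<Rightarrow> 'z::real_vector"
  assumes "awalk u p v"
  shows "\<exists>r s m k. awalk u r m \<and> apath m s v \<and>
    set (awalk_verts u r) = set (awalk_verts u p) \<and> set (awalk_verts m s) \<subseteq> set (awalk_verts u p) \<and>
    length r + card (verts G) \<le> card (verts G) * card (set (awalk_verts u p)) \<and>
    (\<forall>c. k c > 0 \<longrightarrow> cycle c \<and> (\<exists>x\<in>set (awalk_verts u p). awalk x c x)) \<and>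
    sum_list (map lab p) = sum_list (map lab (r @ s)) + (\<Sum>c | cycle c. real (k c) *\<^sub>R sum_list (map lab c))"
  using assms
proof (induction p arbitrary: v rule: rev_induct)
  case Nil
  then show ?case
    by (intro exI[of _ "[]"] exI[of _ v] exI[of _ "\<lambda>_. 0"]) (auto simp: awalk_Nil_iff apath_Nil_iff)
next
  case (snoc e p)
  let ?n = "card (verts G)"
  define t where "t = awlast u p"
  have e: "awalk u p t" "awalk t [e] v" using snoc.prems by (auto simp: t_def)
  then have ev: "e \<in> arcs G" "tail G e = t" "head G e = v" by (auto simp: awalk_simps)
  from snoc.IH[OF e(1)] obtain r s m k where IH: "awalk u r m" "apath m s t"
    "set (awalk_verts u r) = set (awalk_verts u p)" "set (awalk_verts m s) \<subseteq> set (awalk_verts u p)"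
    "length r + ?n \<le> ?n * card (set (awalk_verts u p))"
    and k: "\<And>c. k c > 0 \<Longrightarrow> cycle c \<and> (\<exists>x\<in>set (awalk_verts u p). awalk x c x)"
    and lab: "sum_list (map lab p) = sum_list (map lab (r @ s)) + (\<Sum>c | cycle c. real (k c) *\<^sub>R sum_list (map lab c))"
    by blast
  have s: "awalk m s t" "distinct (awalk_verts m s)" using IH(2) by (auto simp: apath_def)
  have t: "t \<in> set (awalk_verts u p)" using e(1) by auto
  have ts: "t \<in> set (awalk_verts m s)" using s(1) by auto
  have vp: "set (awalk_verts u (p @ [e])) = insert v (set (awalk_verts u p))"
    using set_awalk_verts_append[OF e] t ev by auto
  show ?case
  proof (cases "v \<in> set (awalk_verts u p)")
    case False
    have se: "awalk m (s @ [e]) v" by (rule awalk_appendI[OF s(1) e(2)])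
    have "set (awalk_verts m (s @ [e])) = insert v (set (awalk_verts m s))"
      using set_awalk_verts_append[OF s(1) e(2)] ts ev by auto
    then have "set (awalk_verts u (r @ s @ [e])) = insert v (set (awalk_verts u p))"
      using set_awalk_verts_append[OF IH(1) se] IH(3,4) by auto
    moreover have "awalk u (r @ s @ [e]) v" by (rule awalk_appendI[OF IH(1) se])
    \<comment> \<open>A path has fewer arcs than there are vertices, so \<open>s @ [e]\<close> adds
      at most \<open>?n\<close> arcs to \<open>r\<close>: exactly the allowance for one new
      vertex.\<close>
    moreover have "length s < ?n" using length_apath_less[OF IH(2)] .
    moreover have "card (insert v (set (awalk_verts u p))) = Suc (card (set (awalk_verts u p)))"
      using False by simp
    moreover have "apath v [] v" using awalk_last_in_verts[OF e(2)] by (simp add: apath_Nil_iff)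
    ultimately show ?thesis using IH(5) lab k unfolding vp
      by (intro exI[of _ "r @ s @ [e]"] exI[of _ "[]"] exI[of _ v] exI[of _ k]) (auto simp: add_ac)
  next
    case True
    then have vp': "set (awalk_verts u (p @ [e])) = set (awalk_verts u p)" using vp by auto
    show ?thesis
    proof (cases "v \<in> set (awalk_verts m s)")
      case False
      have "awalk m (s @ [e]) v" by (rule awalk_appendI[OF s(1) e(2)])
      moreover from this have "awalk_verts m (s @ [e]) = awalk_verts m s @ [v]"
        using awalk_verts_append[of m s "[e]" v] s(1) ev by auto
      ultimately show ?thesis using IH lab k s False True unfolding vp'
        by (intro exI[of _ r] exI[of _ "s @ [e]"] exI[of _ m] exI[of _ k]) (auto simp: apath_def add_ac)
    next
      case v: True
      obtain a b where ab: "s = a @ b" "awalk m a v" "awalk v b t"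
        using awalk_decomp[OF s(1) v] by blast
      have vs: "awalk_verts m s = awalk_verts m a @ tl (awalk_verts v b)"
        using awalk_verts_append[of m a b t] s(1) ab by auto
      have be: "awalk v (b @ [e]) v" by (rule awalk_appendI[OF ab(3) e(2)])
      have "awalk_verts v (b @ [e]) = awalk_verts v b @ [v]"
        using awalk_verts_append[of v b "[e]" v] be ab(3) ev by auto
      moreover have "v \<in> set (awalk_verts m a)" using ab(2) by auto
      ultimately have "distinct (tl (awalk_verts v (b @ [e])))"
        using s(2) unfolding vs by auto
      then have cyc: "cycle (b @ [e])" using be by (auto simp: cycle_def)
      have pa: "apath m a v" using ab(2) s(2) unfolding vs by (auto simp: apath_def)
      define k' where "k' = k(b @ [e] := Suc (k (b @ [e])))"
      have "(\<Sum>c | cycle c. real (k' c) *\<^sub>R sum_list (map lab c))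
          = (\<Sum>c | cycle c. real (k c) *\<^sub>R sum_list (map lab c)) + sum_list (map lab (b @ [e]))"
      proof -
        have "(\<Sum>c | cycle c. real (k' c) *\<^sub>R sum_list (map lab c))
          = (\<Sum>c | cycle c. real (k c) *\<^sub>R sum_list (map lab c)
              + (if c = b @ [e] then sum_list (map lab (b @ [e])) else 0))"
          by (intro sum.cong) (auto simp: k'_def scaleR_add_left)
        then show ?thesis using cyc finite_cycles by (simp add: sum.distrib)
      qed
      then have "sum_list (map lab (p @ [e])) = sum_list (map lab (r @ a))
          + (\<Sum>c | cycle c. real (k' c) *\<^sub>R sum_list (map lab c))"
        using lab by (simp add: ab(1) add_ac)
      moreover have "cycle c \<and> (\<exists>x\<in>set (awalk_verts u p). awalk x c x)" if "k' c > 0" for c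
        using that k[of c] cyc be True by (cases "c = b @ [e]") (auto simp: k'_def)
      moreover have "set (awalk_verts m a) \<subseteq> set (awalk_verts u p)" using IH(4) unfolding vs by auto
      ultimately show ?thesis using IH pa unfolding vp'
        by (intro exI[of _ r] exI[of _ a] exI[of _ m] exI[of _ k']) auto
    qed
  qed
qed

text \<open>The pieces \<open>r\<close> and \<open>s\<close> are joined: \<open>r\<close> has at
  most \<open>n(n-1)\<close> arcs and \<open>s\<close> fewer than \<open>n\<close>, where
  \<open>n\<close> is the number of vertices. The joined walk visits every vertex of
  \<open>p\<close>, so the split-off cycles still meet it.\<close>

lemma walk_decomposition:
  fixes lab :: "'b \<Rightarrow> 'z::real_vector"
  assumes "awalk u p v"
  obtains p' k where "awalk u p' v" "length p' \<le> card (verts G) * card (verts G)"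
    "\<And>c. k c > 0 \<Longrightarrow> cycle c \<and> (\<exists>x\<in>set (awalk_verts u p'). awalk x c x)"
    "sum_list (map lab p) = sum_list (map lab p') + (\<Sum>c | cycle c. real (k c) *\<^sub>R sum_list (map lab c))"
proof -
  let ?n = "card (verts G)"
  from walk_decomposition_aux[OF assms, of lab] obtain r s m k where *: "awalk u r m" "apath m s v"
    "set (awalk_verts u r) = set (awalk_verts u p)"
    "length r + ?n \<le> ?n * card (set (awalk_verts u p))"
    "\<And>c. k c > 0 \<Longrightarrow> cycle c \<and> (\<exists>x\<in>set (awalk_verts u p). awalk x c x)"
    "sum_list (map lab p) = sum_list (map lab (r @ s)) + (\<Sum>c | cycle c. real (k c) *\<^sub>R sum_list (map lab c))"
    by blast
  have s: "awalk m s v" using *(2) by (auto simp: apath_def)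
  have "card (set (awalk_verts u p)) \<le> ?n" using assms by (intro card_mono) (auto elim!: awalkE')
  then have "?n * card (set (awalk_verts u p)) \<le> ?n * ?n" by simp
  then have "length (r @ s) \<le> ?n * ?n" using *(4) length_apath_less[OF *(2)] unfolding length_append by linarith
  moreover have "set (awalk_verts u p) \<subseteq> set (awalk_verts u (r @ s))"
    using set_awalk_verts_append[OF *(1) s] *(3) by auto
  ultimately show ?thesis using that[of "r @ s" k] awalk_appendI[OF *(1) s] *(5,6) by blast
qed

end

section \<open>The growth of a periodic graph\<close>

locale rooted_periodic_graph = periodic_graph n \<Gamma>
  for n :: nat and \<Gamma> :: "('v, 'e, 'l::euclidean_space) periodic_graph_data" +
  fixes root :: 'v
  assumes root_in_verts: "root \<in> verts (digraph_of \<Gamma>)"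
begin

sublocale G: wf_digraph "digraph_of \<Gamma>" by (rule wf)

sublocale Q: fin_digraph "quotient_graph \<Gamma>"
proof -
  interpret wf_digraph "quotient_graph \<Gamma>" by (rule wf_quotient_graph)
  show "fin_digraph (quotient_graph \<Gamma>)"
    by unfold_locales (simp_all add: quotient_graph_sel finite_vorbits finite_eorbits)
qed

section \<open>Orbit representatives and lattice coordinates\<close>

lemma vorbit_eqI:
  assumes "x \<in> verts (digraph_of \<Gamma>)" "y \<in> vorbit \<Gamma> x"
  shows "y \<in> verts (digraph_of \<Gamma>)" "vorbit \<Gamma> y = vorbit \<Gamma> x"
proof -
  obtain a where a: "a \<in> lattice \<Gamma>" "y = vact \<Gamma> a x" using assms by (auto simp: vorbit_def)
  then show "y \<in> verts (digraph_of \<Gamma>)" using assms by (simp add: vact_closed)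
  have "vact \<Gamma> b y = vact \<Gamma> (b + a) x" if "b \<in> lattice \<Gamma>" for b
    using that a assms by (simp add: vact_add)
  then have "vorbit \<Gamma> y = (\<lambda>b. vact \<Gamma> (b + a) x) ` lattice \<Gamma>" by (auto simp: vorbit_def)
  also have "\<dots> = (\<lambda>b. vact \<Gamma> b x) ` ((\<lambda>b. b + a) ` lattice \<Gamma>)" by (simp add: image_image)
  also have "(\<lambda>b. b + a) ` lattice \<Gamma> = lattice \<Gamma>"
  proof
    show "lattice \<Gamma> \<subseteq> (\<lambda>b. b + a) ` lattice \<Gamma>"
    proof
      fix b assume "b \<in> lattice \<Gamma>"
      then show "b \<in> (\<lambda>b. b + a) ` lattice \<Gamma>"
        using lattice_diff[OF _ a(1)] by (intro image_eqI[of _ _ "b - a"]) auto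
    qed
  qed (auto simp: lattice_add a)
  finally show "vorbit \<Gamma> y = vorbit \<Gamma> x" by (simp add: vorbit_def)
qed

text \<open>The root represents its own orbit, so quotient walks from that orbit lift to walks from
  the root itself with initial shift 0.\<close>

definition orbit_rep :: "'v set \<Rightarrow> 'v" where
  "orbit_rep X = (if root \<in> X then root else SOME x. x \<in> X)"

lemma orbit_rep:
  assumes "X \<in> verts (quotient_graph \<Gamma>)"
  shows "orbit_rep X \<in> X" "orbit_rep X \<in> verts (digraph_of \<Gamma>)" "vorbit \<Gamma> (orbit_rep X) = X"
proof -
  obtain x where x: "x \<in> verts (digraph_of \<Gamma>)" "X = vorbit \<Gamma> x"
    using assms by (auto simp: quotient_graph_sel)
  show *: "orbit_rep X \<in> X"
    using someI[of "\<lambda>x. x \<in> X"] vorbit_self[OF x(1)] by (auto simp: orbit_rep_def x(2))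
  show "orbit_rep X \<in> verts (digraph_of \<Gamma>)" "vorbit \<Gamma> (orbit_rep X) = X"
    using vorbit_eqI[OF x(1)] * by (simp_all add: x(2))
qed

lemma orbit_rep_root [simp]: "orbit_rep (vorbit \<Gamma> root) = root"
  using vorbit_self[OF root_in_verts] by (simp add: orbit_rep_def)

lemma in_orbit_rep:
  assumes "X \<in> verts (quotient_graph \<Gamma>)" "y \<in> X"
  obtains a where "a \<in> lattice \<Gamma>" "y = vact \<Gamma> a (orbit_rep X)"
  using assms orbit_rep(3)[OF assms(1)] by (auto simp: vorbit_def)

text \<open>
  Fixing orbit representatives identifies the vertices with pairs of an orbit and a lattice element,
  and every arc of the quotient then carries a lattice element, additive along walks.
\<close>

definition arc_shift :: "'e set \<Rightarrow> 'l" where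
  "arc_shift C = (SOME a. a \<in> lattice \<Gamma> \<and> (\<exists>e\<in>arcs (digraph_of \<Gamma>). eorbit \<Gamma> e = C \<and>
     tail (digraph_of \<Gamma>) e = orbit_rep (tail (quotient_graph \<Gamma>) C) \<and>
     head (digraph_of \<Gamma>) e = vact \<Gamma> a (orbit_rep (head (quotient_graph \<Gamma>) C))))"

lemma arc_shift:
  assumes "C \<in> arcs (quotient_graph \<Gamma>)"
  shows "arc_shift C \<in> lattice \<Gamma> \<and> (\<exists>e\<in>arcs (digraph_of \<Gamma>). eorbit \<Gamma> e = C \<and>
     tail (digraph_of \<Gamma>) e = orbit_rep (tail (quotient_graph \<Gamma>) C) \<and>
     head (digraph_of \<Gamma>) e = vact \<Gamma> (arc_shift C) (orbit_rep (head (quotient_graph \<Gamma>) C)))"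
  unfolding arc_shift_def
proof (rule someI_ex)
  obtain e where e: "e \<in> arcs (digraph_of \<Gamma>)" "C = eorbit \<Gamma> e"
    using assms by (auto simp: quotient_graph_sel)
  have tl: "tail (quotient_graph \<Gamma>) C = vorbit \<Gamma> (tail (digraph_of \<Gamma>) e)"
    and hd: "head (quotient_graph \<Gamma>) C = vorbit \<Gamma> (head (digraph_of \<Gamma>) e)"
    using e by (simp_all add: quotient_graph_sel tail_eorbit head_eorbit)
  have "orbit_rep (tail (quotient_graph \<Gamma>) C) \<in> vorbit \<Gamma> (tail (digraph_of \<Gamma>) e)"
    using orbit_rep(1)[OF Q.tail_in_verts[OF assms]] by (simp add: tl)
  then obtain a where a: "a \<in> lattice \<Gamma>"
    "orbit_rep (tail (quotient_graph \<Gamma>) C) = vact \<Gamma> a (tail (digraph_of \<Gamma>) e)"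
    by (auto simp: vorbit_def)
  \<comment> \<open>Translate \<open>e\<close> so that its tail is the representative; the shift can
    then be read off at its head.\<close>
  let ?e = "eact \<Gamma> a e"
  have "head (digraph_of \<Gamma>) ?e \<in> head (quotient_graph \<Gamma>) C"
    unfolding hd using a e by (simp add: head_eact vorbit_def)
  then obtain b where "b \<in> lattice \<Gamma>"
    "head (digraph_of \<Gamma>) ?e = vact \<Gamma> b (orbit_rep (head (quotient_graph \<Gamma>) C))"
    using in_orbit_rep[OF Q.head_in_verts[OF assms]] by blast
  then show "\<exists>a. a \<in> lattice \<Gamma> \<and> (\<exists>e\<in>arcs (digraph_of \<Gamma>). eorbit \<Gamma> e = C \<and>
     tail (digraph_of \<Gamma>) e = orbit_rep (tail (quotient_graph \<Gamma>) C) \<and>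
     head (digraph_of \<Gamma>) e = vact \<Gamma> a (orbit_rep (head (quotient_graph \<Gamma>) C)))"
    using a e by (intro exI[of _ b] conjI bexI[of _ ?e])
      (simp_all add: eorbit_eact tail_eact eact_closed)
qed

abbreviation walk_shift :: "'e set list \<Rightarrow> 'l" where
  "walk_shift q \<equiv> sum_list (map arc_shift q)"

lemma walk_shift_in_lattice:
  "set q \<subseteq> arcs (quotient_graph \<Gamma>) \<Longrightarrow> walk_shift q \<in> lattice \<Gamma>"
  by (induction q) (auto simp: lattice_zero lattice_add arc_shift)

text \<open>The arc witnessing \<open>arc_shift C\<close>, translated by \<open>a\<close>, leads
  from lattice coordinate \<open>a\<close> to \<open>a + arc_shift C\<close>; along a walk these
  shifts accumulate.\<close>

lemma lift_walk_shift:
  assumes "Q.awalk X q Y" "a \<in> lattice \<Gamma>"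
  shows "\<exists>p. G.awalk (vact \<Gamma> a (orbit_rep X)) p (vact \<Gamma> (a + walk_shift q) (orbit_rep Y)) \<and>
    map (eorbit \<Gamma>) p = q"
  using assms
proof (induction q arbitrary: X a)
  case Nil
  then show ?case
    by (intro exI[of _ "[]"]) (auto simp: G.awalk_Nil_iff Q.awalk_Nil_iff orbit_rep vact_closed)
next
  case (Cons C q)
  then have C: "C \<in> arcs (quotient_graph \<Gamma>)" "X = tail (quotient_graph \<Gamma>) C"
    and q: "Q.awalk (head (quotient_graph \<Gamma>) C) q Y" by (auto simp: Q.awalk_Cons_iff)
  from arc_shift[OF C(1)] obtain e where b: "arc_shift C \<in> lattice \<Gamma>"
    and e: "e \<in> arcs (digraph_of \<Gamma>)" "eorbit \<Gamma> e = C" "tail (digraph_of \<Gamma>) e = orbit_rep X"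
    "head (digraph_of \<Gamma>) e = vact \<Gamma> (arc_shift C) (orbit_rep (head (quotient_graph \<Gamma>) C))"
    by (auto simp: C)
  from Cons.IH[OF q lattice_add[OF Cons.prems(2) b]] obtain p where
    p: "G.awalk (vact \<Gamma> (a + arc_shift C) (orbit_rep (head (quotient_graph \<Gamma>) C))) p
        (vact \<Gamma> (a + arc_shift C + walk_shift q) (orbit_rep Y))" "map (eorbit \<Gamma>) p = q" by blast
  have "head (digraph_of \<Gamma>) (eact \<Gamma> a e) = vact \<Gamma> (a + arc_shift C) (orbit_rep (head (quotient_graph \<Gamma>) C))"
    using e Cons.prems(2) b orbit_rep(2)[OF Q.head_in_verts[OF C(1)]] by (simp add: head_eact vact_add)
  then show ?case using e p Cons.prems(2)
    by (intro exI[of _ "eact \<Gamma> a e # p"])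
       (simp add: G.awalk_Cons_iff eact_closed tail_eact eorbit_eact add.assoc)
qed

lemma project_walk:
  "G.awalk x p y \<Longrightarrow> Q.awalk (vorbit \<Gamma> x) (map (eorbit \<Gamma>) p) (vorbit \<Gamma> y)"
  by (induction p arbitrary: x)
     (auto simp: G.awalk_simps Q.awalk_simps quotient_graph_sel tail_eorbit head_eorbit)

lemma walk_weight_project:
  "set p \<subseteq> arcs (digraph_of \<Gamma>) \<Longrightarrow>
    walk_weight (quotient_weight \<Gamma>) (map (eorbit \<Gamma>) p) = walk_weight (weight \<Gamma>) p"
  by (induction p) (auto simp: walk_weight_def quotient_weight_eorbit)

text \<open>The lift starting at a representative ends at its translate by
  \<open>walk_shift c\<close>, and the displacement does not depend on the lift.\<close>

lemma cycle_displacement_walk_shift: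
  assumes "Q.cycle c"
  shows "cycle_displacement \<Gamma> c = walk_shift c"
proof -
  obtain X where X: "Q.awalk X c X" using assms by (auto simp: Q.cycle_def)
  then have "X \<in> verts (quotient_graph \<Gamma>)" by auto
  then have *: "vact \<Gamma> 0 (orbit_rep X) = orbit_rep X" by (simp add: vact_zero orbit_rep)
  from lift_walk_shift[OF X lattice_zero] obtain p where
    "G.awalk (orbit_rep X) p (vact \<Gamma> (walk_shift c) (orbit_rep X))" "map (eorbit \<Gamma>) p = c"
    unfolding * by auto
  moreover have "walk_shift c \<in> lattice \<Gamma>" using X by (intro walk_shift_in_lattice) auto
  ultimately show ?thesis using assms by (intro cycle_displacement_eq) (auto simp: is_quotient_cycle_def)
qed

lemma length_le_walk_weight:
  "set q \<subseteq> arcs (quotient_graph \<Gamma>) \<Longrightarrow> length q \<le> walk_weight (quotient_weight \<Gamma>) q"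
proof (induction q)
  case (Cons C q)
  then obtain e where "e \<in> arcs (digraph_of \<Gamma>)" "C = eorbit \<Gamma> e" by (auto simp: quotient_graph_sel)
  then have "quotient_weight \<Gamma> C > 0" using weight_pos by (simp add: quotient_weight_eorbit)
  then show ?case using Cons by (simp add: walk_weight_def)
qed (simp add: walk_weight_def)

text \<open>The pairs of a vertex and an upper bound \<open>d\<close> for its distance from the root.\<close>

definition ball_module :: "('v set \<times> 'l \<times> nat) set" where
  "ball_module = {(Y, walk_shift q, d) | Y q d.
     Q.awalk (vorbit \<Gamma> root) q Y \<and> walk_weight (quotient_weight \<Gamma>) q \<le> d}"

section \<open>Balls around the root and the growth series\<close>

lemma graph_dist_le_iff:
  "graph_dist \<Gamma> x y \<le> enat d \<longleftrightarrow> (\<exists>p. G.awalk x p y \<and> walk_weight (weight \<Gamma>) p \<le> d)"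
proof -
  \<comment> \<open>The strict form is convenient: an infimum strictly below a value is witnessed by
    an element.\<close>
  have "graph_dist \<Gamma> x y \<le> enat d \<longleftrightarrow> graph_dist \<Gamma> x y < enat (Suc d)"
    by (cases "graph_dist \<Gamma> x y") auto
  also have "\<dots> \<longleftrightarrow> (\<exists>p. G.awalk x p y \<and> walk_weight (weight \<Gamma>) p < Suc d)"
    unfolding graph_dist_def by (simp add: INF_less_iff)
  finally show ?thesis by (simp add: less_Suc_eq_le)
qed

text \<open>Walks project to the quotient and lift back with the same weight, which gives
  surjectivity; freeness of the action makes the coordinates of a vertex unique.\<close>

lemma bij_betw_ball_module:
  "bij_betw (\<lambda>(Y, a, d). vact \<Gamma> a (orbit_rep Y)) {z \<in> ball_module. snd (snd z) = d}
     {y \<in> verts (digraph_of \<Gamma>). graph_dist \<Gamma> root y \<le> enat d}"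
proof (rule bij_betw_imageI)
  let ?f = "\<lambda>(Y, a, d :: nat). vact \<Gamma> a (orbit_rep Y)"
  let ?w = "walk_weight (quotient_weight \<Gamma>)"
  have lift: "\<exists>p. G.awalk root p (vact \<Gamma> (walk_shift q) (orbit_rep Y)) \<and> map (eorbit \<Gamma>) p = q"
    if "Q.awalk (vorbit \<Gamma> root) q Y" for q Y
    using lift_walk_shift[OF that lattice_zero] by (simp add: vact_zero root_in_verts)
  show "inj_on ?f {z \<in> ball_module. snd (snd z) = d}"
  proof (rule inj_onI, clarsimp simp: ball_module_def)
    fix X Y p q
    assume p: "Q.awalk (vorbit \<Gamma> root) p X" and q: "Q.awalk (vorbit \<Gamma> root) q Y"
      and eq: "vact \<Gamma> (walk_shift p) (orbit_rep X) = vact \<Gamma> (walk_shift q) (orbit_rep Y)"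
    have X: "X \<in> verts (quotient_graph \<Gamma>)" "walk_shift p \<in> lattice \<Gamma>"
      and Y: "Y \<in> verts (quotient_graph \<Gamma>)" "walk_shift q \<in> lattice \<Gamma>"
      using p q by (auto intro!: walk_shift_in_lattice)
    have "vorbit \<Gamma> (vact \<Gamma> (walk_shift p) (orbit_rep X)) = X"
      using vorbit_eqI(2)[OF orbit_rep(2)[OF X(1)]] orbit_rep(3)[OF X(1)] X(2) by (auto simp: vorbit_def)
    moreover have "vorbit \<Gamma> (vact \<Gamma> (walk_shift q) (orbit_rep Y)) = Y"
      using vorbit_eqI(2)[OF orbit_rep(2)[OF Y(1)]] orbit_rep(3)[OF Y(1)] Y(2) by (auto simp: vorbit_def)
    ultimately have "X = Y" using eq by simp
    then show "X = Y \<and> walk_shift p = walk_shift q"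
      using vact_inj[OF X(2) Y(2) orbit_rep(2)[OF Y(1)]] eq by simp
  qed
  show "?f ` {z \<in> ball_module. snd (snd z) = d} = {y \<in> verts (digraph_of \<Gamma>). graph_dist \<Gamma> root y \<le> enat d}"
  proof (intro equalityI subsetI)
    fix y assume "y \<in> ?f ` {z \<in> ball_module. snd (snd z) = d}"
    then obtain Y q where q: "Q.awalk (vorbit \<Gamma> root) q Y" "?w q \<le> d"
      "y = vact \<Gamma> (walk_shift q) (orbit_rep Y)" by (auto simp: ball_module_def)
    from lift[OF q(1)] obtain p where p: "G.awalk root p y" "map (eorbit \<Gamma>) p = q" by (auto simp: q(3))
    then have "walk_weight (weight \<Gamma>) p \<le> d" using q(2) walk_weight_project[of p] by auto
    then show "y \<in> {y \<in> verts (digraph_of \<Gamma>). graph_dist \<Gamma> root y \<le> enat d}"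
      using p by (auto simp: graph_dist_le_iff)
  next
    fix y assume "y \<in> {y \<in> verts (digraph_of \<Gamma>). graph_dist \<Gamma> root y \<le> enat d}"
    then obtain p where p: "G.awalk root p y" "walk_weight (weight \<Gamma>) p \<le> d"
      by (auto simp: graph_dist_le_iff)
    define q where q_def: "q = map (eorbit \<Gamma>) p"
    have q: "Q.awalk (vorbit \<Gamma> root) q (vorbit \<Gamma> y)" unfolding q_def by (rule project_walk[OF p(1)])
    obtain p' where p': "G.awalk root p' (vact \<Gamma> (walk_shift q) (orbit_rep (vorbit \<Gamma> y)))"
      "map (eorbit \<Gamma>) p' = map (eorbit \<Gamma>) p" using lift[OF q] by (auto simp: q_def)
    \<comment> \<open>Both \<open>p\<close> and \<open>p'\<close> lift \<open>q\<close> from the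
      root, so by unique lifting they have the same end.\<close>
    have "vact \<Gamma> (walk_shift q) (orbit_rep (vorbit \<Gamma> y)) = vact \<Gamma> 0 y"
      by (rule lift_translate[OF p(1) _ p'(2)[symmetric] lattice_zero])
         (use p'(1) in \<open>simp add: vact_zero root_in_verts\<close>)
    moreover have "y \<in> verts (digraph_of \<Gamma>)" using p(1) by auto
    ultimately have y: "y = vact \<Gamma> (walk_shift q) (orbit_rep (vorbit \<Gamma> y))" by (simp add: vact_zero)
    have "?w q \<le> d" using p walk_weight_project[of p] by (auto simp: q_def)
    then have "(vorbit \<Gamma> y, walk_shift q, d) \<in> {z \<in> ball_module. snd (snd z) = d}"
      using q by (auto simp: ball_module_def)
    then show "y \<in> ?f ` {z \<in> ball_module. snd (snd z) = d}"
      using y by (intro image_eqI[of _ _ "(vorbit \<Gamma> y, walk_shift q, d)"]) auto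
  qed
qed

text \<open>Weights are positive integers, so the bound \<open>d\<close> on the weight also bounds
  the length, and the quotient has finitely many arcs.\<close>

lemma finite_ball_module: "finite {z \<in> ball_module. snd (snd z) = d}"
proof (rule finite_subset)
  let ?A = "{q. set q \<subseteq> arcs (quotient_graph \<Gamma>) \<and> length q \<le> d}"
  show "{z \<in> ball_module. snd (snd z) = d} \<subseteq> verts (quotient_graph \<Gamma>) \<times> walk_shift ` ?A \<times> {d}"
  proof (clarsimp simp: ball_module_def)
    fix Y q assume q: "Q.awalk (vorbit \<Gamma> root) q Y" "walk_weight (quotient_weight \<Gamma>) q \<le> d"
    then have "q \<in> ?A" using length_le_walk_weight[of q] by auto
    then show "Y \<in> verts (quotient_graph \<Gamma>) \<and> walk_shift q \<in> walk_shift ` ?A" using q(1) by blast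
  qed
  show "finite (verts (quotient_graph \<Gamma>) \<times> walk_shift ` ?A \<times> {d})"
    by (intro finite_cartesian_product finite_imageI finite_lists_length_le) auto
qed

text \<open>A sphere is the difference of two consecutive balls, and multiplication by
  \<open>1 - X\<close> takes differences of coefficients.\<close>

lemma growth_series_eq: "growth_series \<Gamma> root = (1 - fps_X) * hilbert_series (\<lambda>z. snd (snd z)) ball_module"
proof (rule fps_ext)
  fix d
  define A where "A d = {y \<in> verts (digraph_of \<Gamma>). graph_dist \<Gamma> root y \<le> enat d}" for d
  have fin: "finite (A d)" for d
    unfolding A_def using bij_betw_finite[OF bij_betw_ball_module] finite_ball_module by blast
  have card: "card {z \<in> ball_module. snd (snd z) = d} = card (A d)" for d
    unfolding A_def by (rule bij_betw_same_card[OF bij_betw_ball_module])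
  \<comment> \<open>Since \<open>d - 1\<close> is truncated, \<open>d = 0\<close> is separated:
    there the sphere is the whole ball.\<close>
  have "{y \<in> verts (digraph_of \<Gamma>). graph_dist \<Gamma> root y = enat d} = (if d = 0 then A d else A d - A (d - 1))"
  proof -
    have "graph_dist \<Gamma> root y = enat d \<longleftrightarrow> graph_dist \<Gamma> root y \<le> enat d \<and> (d = 0 \<or> \<not> graph_dist \<Gamma> root y \<le> enat (d - 1))" for y
      by (cases "graph_dist \<Gamma> root y") auto
    then show ?thesis by (auto simp: A_def)
  qed
  moreover have "A (d - 1) \<subseteq> A d" by (auto simp: A_def intro: order_trans)
  then have "card (A d - A (d - 1)) = card (A d) - card (A (d - 1))" "card (A (d - 1)) \<le> card (A d)"
    using fin by (auto intro: card_Diff_subset card_mono)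
  ultimately have "(of_nat (growth_seq \<Gamma> root d) :: complex)
      = of_nat (card (A d)) - (if d = 0 then 0 else of_nat (card (A (d - 1))))"
    by (simp add: growth_seq_def of_nat_diff)
  then show "fps_nth (growth_series \<Gamma> root) d
      = fps_nth ((1 - fps_X) * hilbert_series (\<lambda>z. snd (snd z)) ball_module) d"
    by (simp add: growth_series_def left_diff_distrib card)
qed

end

text \<open>
  Adds \<open>c v\<close> copies of \<open>(w v \<cdot> v, w v)\<close> for each \<open>v\<close>. The index \<open>v = 0\<close> with \<open>w 0 = 1\<close> stands for the
  generator \<open>(0, 1)\<close>, which only raises the distance bound.
\<close>

definition translate :: "'l::real_vector set \<Rightarrow> ('l \<Rightarrow> nat) \<Rightarrow> 'k \<times> 'l \<times> nat \<Rightarrow> ('l \<Rightarrow> nat) \<Rightarrow> 'k \<times> 'l \<times> nat" where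
  "translate J w = (\<lambda>(Y, a, d) c.
     (Y, a + (\<Sum>v\<in>J. real (c v * w v) *\<^sub>R v), d + (\<Sum>v\<in>J. c v * w v)))"

section \<open>Finite generation of the ball module\<close>

context rooted_periodic_graph
begin

text \<open>Shift and weight in one real vector space, so that the results on walks treat both at
  once.\<close>

definition arc_label :: "'e set \<Rightarrow> 'l \<times> real" where
  "arc_label C = (arc_shift C, real (quotient_weight \<Gamma> C))"

lemma sum_list_arc_label:
  "sum_list (map arc_label q) = (walk_shift q, real (walk_weight (quotient_weight \<Gamma>) q))"
  by (induction q) (auto simp: arc_label_def walk_weight_def zero_prod_def)

text \<open>The closed walks of \<open>loop\<close> give stability under \<open>translate\<close>.
  Conversely, \<open>k c\<close> copies of a cycle \<open>c\<close> have the label of a combination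
  of generators, so of \<open>l c\<close> copies in a decomposed walk only
  \<open>l c mod k c\<close> must be kept.\<close>

lemma ball_module_finitely_generated:
  assumes J: "finite J" "0 \<in> J" "w 0 = 1"
    and loop: "\<And>v. v \<in> J \<Longrightarrow> v \<noteq> 0 \<Longrightarrow>
      \<exists>z. Q.awalk (vorbit \<Gamma> root) z (vorbit \<Gamma> root) \<and> sum_list (map arc_label z) = real (w v) *\<^sub>R (v, 1)"
    and mult: "\<And>c. Q.cycle c \<Longrightarrow> \<exists>k>0. \<exists>m.
      real k *\<^sub>R sum_list (map arc_label c) = (\<Sum>v\<in>J. real (m v * w v) *\<^sub>R (v, 1))"
  shows "\<exists>F. finite F \<and> ball_module = (\<Union>z\<in>F. translate J w z ` exponents J)"
proof -
  let ?lab = "\<lambda>q. sum_list (map arc_label q)" and ?X = "vorbit \<Gamma> root"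
  let ?n = "card (verts (quotient_graph \<Gamma>)) * card (verts (quotient_graph \<Gamma>))"
  have "\<forall>c. \<exists>k. Q.cycle c \<longrightarrow> k > 0 \<and> (\<exists>m. real k *\<^sub>R ?lab c = (\<Sum>v\<in>J. real (m v * w v) *\<^sub>R (v, 1)))"
    using mult by blast
  from choice[OF this] obtain k where k: "\<And>c. Q.cycle c \<Longrightarrow> k c > (0::nat)"
    and "\<forall>c. \<exists>m. Q.cycle c \<longrightarrow> real (k c) *\<^sub>R ?lab c = (\<Sum>v\<in>J. real (m v * w v) *\<^sub>R (v, 1))" by blast
  from choice[OF this(2)] obtain m where
    m: "\<And>c. Q.cycle c \<Longrightarrow> real (k c) *\<^sub>R ?lab c = (\<Sum>v\<in>J. real (m c v * w v) *\<^sub>R (v, 1))" by blast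
  have "\<forall>v. \<exists>z. v \<in> J \<longrightarrow> v \<noteq> 0 \<longrightarrow> Q.awalk ?X z ?X \<and> ?lab z = real (w v) *\<^sub>R (v, 1)"
    using loop by blast
  from choice[OF this] obtain z where z: "\<And>v. v \<in> J \<Longrightarrow> v \<noteq> 0 \<Longrightarrow> Q.awalk ?X (z v) ?X"
    "\<And>v. v \<in> J \<Longrightarrow> v \<noteq> 0 \<Longrightarrow> ?lab (z v) = real (w v) *\<^sub>R (v, 1)" by blast
  define short where "short = {p. set p \<subseteq> arcs (quotient_graph \<Gamma>) \<and> length p \<le> ?n}"
  define rem where "rem = {r. \<forall>c. (c \<in> {c. Q.cycle c} \<longrightarrow> r c \<in> {..Max (k ` {c. Q.cycle c})}) \<and> (c \<notin> {c. Q.cycle c} \<longrightarrow> r c = (0::nat))}"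
  \<comment> \<open>The generators are selected by their labels: a short walk plus bounded multiples
    of cycles. Such labels are finite in number.\<close>
  define F where "F = {b \<in> ball_module. \<exists>p\<in>short. \<exists>r\<in>rem.
    (fst (snd b), real (snd (snd b))) = ?lab p + (\<Sum>c | Q.cycle c. real (r c) *\<^sub>R ?lab c)}"
  have "finite short" unfolding short_def by (intro finite_lists_length_le) simp
  moreover have "finite rem" unfolding rem_def using Q.finite_cycles by (intro finite_set_of_finite_funs) auto
  ultimately have "finite (verts (quotient_graph \<Gamma>) \<times>
      (\<lambda>(p, r). ?lab p + (\<Sum>c | Q.cycle c. real (r c) *\<^sub>R ?lab c)) ` (short \<times> rem))" (is "finite ?T")
    by simp
  moreover have "(\<lambda>(Y, a, d). (Y, a, real d)) ` F \<subseteq> ?T"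
  proof clarsimp
    fix Y a d assume "(Y, a, d) \<in> F"
    then obtain p r where "p \<in> short" "r \<in> rem"
      "(a, real d) = ?lab p + (\<Sum>c | Q.cycle c. real (r c) *\<^sub>R ?lab c)" "(Y, a, d) \<in> ball_module"
      by (auto simp: F_def)
    then show "Y \<in> verts (quotient_graph \<Gamma>) \<and> (a, real d) \<in>
        (\<lambda>(p, r). ?lab p + (\<Sum>c | Q.cycle c. real (r c) *\<^sub>R ?lab c)) ` (short \<times> rem)"
      by (force simp: ball_module_def)
  qed
  ultimately have "finite ((\<lambda>(Y, a, d). (Y, a, real d)) ` F)" by (rule rev_finite_subset)
  then have "finite F" by (rule finite_imageD) (auto simp: inj_on_def)
  \<comment> \<open>Insert \<open>c v\<close> copies of \<open>z v\<close> at the orbit of the root;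
    index 0 is treated apart, as it raises only the bound \<open>d\<close>.\<close>
  moreover have "translate J w b c \<in> ball_module" if b: "b \<in> F" for b c
  proof -
    from b obtain Y p d where p: "b = (Y, walk_shift p, d)" "Q.awalk ?X p Y"
      "walk_weight (quotient_weight \<Gamma>) p \<le> d" by (auto simp: F_def ball_module_def)
    have "?X \<in> set (Q.awalk_verts ?X p)" using p(2) by (rule Q.hd_in_awalk_verts)
    then obtain p' where p': "Q.awalk ?X p' Y"
      "?lab p' = ?lab p + (\<Sum>v\<in>J - {0}. real (c v) *\<^sub>R ?lab (z v))"
      using Q.insert_closed_walks[of "J - {0}" ?X p Y c z arc_label] J(1) p(2) z(1) by blast
    have "(\<Sum>v\<in>J - {0}. real (c v) *\<^sub>R ?lab (z v)) = (\<Sum>v\<in>J - {0}. real (c v * w v) *\<^sub>R (v, 1))"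
      by (intro sum.cong) (auto simp: z(2))
    then have sh: "walk_shift p' = walk_shift p + (\<Sum>v\<in>J - {0}. real (c v * w v) *\<^sub>R v)"
      and wt: "real (walk_weight (quotient_weight \<Gamma>) p')
        = real (walk_weight (quotient_weight \<Gamma>) p) + (\<Sum>v\<in>J - {0}. real (c v * w v))"
      using p'(2) by (auto simp: sum_list_arc_label prod_eq_iff fst_sum snd_sum)
    have "real (walk_weight (quotient_weight \<Gamma>) p')
        = real (walk_weight (quotient_weight \<Gamma>) p + (\<Sum>v\<in>J - {0}. c v * w v))" using wt by simp
    then have "walk_weight (quotient_weight \<Gamma>) p'
        = walk_weight (quotient_weight \<Gamma>) p + (\<Sum>v\<in>J - {0}. c v * w v)" by (simp only: of_nat_eq_iff)
    also have "\<dots> \<le> d + (\<Sum>v\<in>J. c v * w v)"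
      using p(3) J(1) by (intro add_mono sum_mono2) auto
    finally have "walk_weight (quotient_weight \<Gamma>) p' \<le> d + (\<Sum>v\<in>J. c v * w v)" .
    moreover have "walk_shift p' = walk_shift p + (\<Sum>v\<in>J. real (c v * w v) *\<^sub>R v)"
      unfolding sh using J by (simp add: sum.remove[of J 0])
    ultimately show ?thesis using p'(1)
      by (auto simp: p(1) ball_module_def translate_def intro!: exI[of _ p'])
  qed
  moreover have "b \<in> (\<Union>z\<in>F. translate J w z ` exponents J)" if b: "b \<in> ball_module" for b
  proof -
    from b obtain Y p d where p: "b = (Y, walk_shift p, d)" "Q.awalk ?X p Y"
      "walk_weight (quotient_weight \<Gamma>) p \<le> d" by (auto simp: ball_module_def)
    obtain p' l where p': "Q.awalk ?X p' Y" "length p' \<le> ?n"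
      and l: "\<And>c. l c > 0 \<Longrightarrow> Q.cycle c \<and> (\<exists>x\<in>set (Q.awalk_verts ?X p'). Q.awalk x c x)"
      and lab: "?lab p = ?lab p' + (\<Sum>c | Q.cycle c. real (l c) *\<^sub>R ?lab c)"
      by (rule Q.walk_decomposition[OF p(2), of arc_label]) (rule that)
    \<comment> \<open>Multiples of \<open>k c\<close> are traded for generators and the remainder is
      reinserted. A cycle with positive remainder occurs in the decomposition, so it meets
      \<open>p'\<close>.\<close>
    define r where "r c = l c mod k c" for c
    have l_pos: "l c > 0" if "r c > 0" for c using that by (auto simp: r_def intro: gr0I)
    have "\<exists>x\<in>set (Q.awalk_verts ?X p'). Q.awalk x c x" if "r c > 0" for c
      using l[OF l_pos[OF that]] by (rule conjunct2)
    then obtain p2 where p2: "Q.awalk ?X p2 Y"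
      "?lab p2 = ?lab p' + (\<Sum>c | Q.cycle c. real (r c) *\<^sub>R ?lab c)"
      using Q.insert_closed_walks[OF Q.finite_cycles p'(1), of r "\<lambda>c. c" arc_label] by blast
    define f where "f = (Y, walk_shift p2, walk_weight (quotient_weight \<Gamma>) p2)"
    have "r \<in> rem"
    proof -
      have "r c \<le> Max (k ` {c. Q.cycle c})" if "Q.cycle c" for c
      proof -
        have "r c \<le> k c" using k[OF that] by (simp add: r_def less_imp_le)
        also have "k c \<le> Max (k ` {c. Q.cycle c})" using that Q.finite_cycles by (intro Max_ge) auto
        finally show ?thesis .
      qed
      moreover have "r c = 0" if "\<not> Q.cycle c" for c
        using that l[of c] by (cases "l c = 0") (auto simp: r_def)
      ultimately show ?thesis by (auto simp: rem_def)
    qed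
    moreover have "p' \<in> short" using p' by (auto simp: short_def)
    moreover have "f \<in> ball_module" using p2(1) by (auto simp: f_def ball_module_def)
    moreover have "(fst (snd f), real (snd (snd f))) = ?lab p2" by (simp add: f_def sum_list_arc_label)
    ultimately have "f \<in> F" unfolding F_def using p2(2) by auto
    \<comment> \<open>\<open>h\<close> collects the generators bought by full multiples of
      \<open>k c\<close>; \<open>t\<close> is the slack between bound and weight, which
      \<open>e\<close> adds at index 0, where \<open>w 0 = 1\<close>.\<close>
    define h where "h v = (\<Sum>c | Q.cycle c. (l c div k c) * m c v)" for v
    define t where "t = d - walk_weight (quotient_weight \<Gamma>) p"
    define e where "e v = (if v \<in> J then h v + (if v = 0 then t else 0) else 0)" for v
    have "real (l c) *\<^sub>R ?lab c = real (r c) *\<^sub>R ?lab c + (\<Sum>v\<in>J. real (l c div k c * m c v * w v) *\<^sub>R (v, 1))"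
      if c: "Q.cycle c" for c
    proof -
      have "real (l c) = real (r c) + real (l c div k c) * real (k c)"
        unfolding r_def by (simp flip: of_nat_mult of_nat_add)
      then have "real (l c) *\<^sub>R ?lab c = real (r c) *\<^sub>R ?lab c + real (l c div k c) *\<^sub>R (real (k c) *\<^sub>R ?lab c)"
        by (simp only: scaleR_add_left scaleR_scaleR)
      also have "real (l c div k c) *\<^sub>R (real (k c) *\<^sub>R ?lab c)
          = (\<Sum>v\<in>J. real (l c div k c * m c v * w v) *\<^sub>R (v, 1))"
        unfolding m[OF c] scaleR_sum_right by (intro sum.cong) (simp_all add: mult.assoc)
      finally show ?thesis .
    qed
    then have "(\<Sum>c | Q.cycle c. real (l c) *\<^sub>R ?lab c) = (\<Sum>c | Q.cycle c. real (r c) *\<^sub>R ?lab c)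
        + (\<Sum>c | Q.cycle c. \<Sum>v\<in>J. real (l c div k c * m c v * w v) *\<^sub>R (v, 1))"
      by (simp add: sum.distrib)
    also have "(\<Sum>c | Q.cycle c. \<Sum>v\<in>J. real (l c div k c * m c v * w v) *\<^sub>R (v, 1::real))
        = (\<Sum>v\<in>J. real (h v * w v) *\<^sub>R (v, 1))"
      unfolding h_def sum_distrib_right of_nat_sum scaleR_sum_left by (rule sum.swap)
    finally have "?lab p = ?lab p2 + (\<Sum>v\<in>J. real (h v * w v) *\<^sub>R (v, 1))"
      unfolding lab p2(2) by (simp add: add.assoc)
    then have sh: "walk_shift p = walk_shift p2 + (\<Sum>v\<in>J. real (h v * w v) *\<^sub>R v)"
      and wt: "real (walk_weight (quotient_weight \<Gamma>) p)
        = real (walk_weight (quotient_weight \<Gamma>) p2 + (\<Sum>v\<in>J. h v * w v))"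
      by (auto simp: sum_list_arc_label prod_eq_iff fst_sum snd_sum)
    have "(\<Sum>v\<in>J. real (e v * w v) *\<^sub>R v) = (\<Sum>v\<in>J. real (h v * w v) *\<^sub>R v)"
      by (intro sum.cong) (auto simp: e_def)
    moreover have "(\<Sum>v\<in>J. e v * w v) = (\<Sum>v\<in>J. h v * w v + (if v = 0 then t else 0))"
      by (intro sum.cong) (auto simp: e_def J(3))
    then have "(\<Sum>v\<in>J. e v * w v) = (\<Sum>v\<in>J. h v * w v) + t"
      using J by (simp add: sum.distrib)
    moreover have "walk_weight (quotient_weight \<Gamma>) p
        = walk_weight (quotient_weight \<Gamma>) p2 + (\<Sum>v\<in>J. h v * w v)"
      using wt by (simp only: of_nat_eq_iff)
    ultimately have "b = translate J w f e"
      using p(3) sh by (simp add: p(1) f_def translate_def t_def)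
    moreover have "e \<in> exponents J" by (auto simp: e_def exponents_def)
    ultimately show ?thesis using \<open>f \<in> F\<close> by blast
  qed
  ultimately show ?thesis by (intro exI[of _ F]) blast
qed

end

section \<open>Rationality of the growth series and the quasi-period\<close>

theorem growth_series_rational:
  fixes \<Gamma> :: "('v, 'e, 'l::euclidean_space) periodic_graph_data"
  assumes "periodic_graph n \<Gamma>" "x\<^sub>0 \<in> verts (digraph_of \<Gamma>)"
    and S: "S = polytope_vertices (growth_polytope \<Gamma>) - {0}"
    and q: "\<And>v. v \<in> S \<Longrightarrow> is_quotient_cycle \<Gamma> (q v) \<and> cycle_direction \<Gamma> (q v) = v \<and>
           vorbit \<Gamma> x\<^sub>0 \<in> walk_supp (quotient_graph \<Gamma>) (q v)"
  shows "finite S" "\<And>v. v \<in> S \<Longrightarrow> cycle_weight \<Gamma> (q v) > 0"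
    "\<exists>Q. growth_series \<Gamma> x\<^sub>0 * (\<Prod>v\<in>S. 1 - fps_X ^ cycle_weight \<Gamma> (q v)) = fps_of_poly Q"
proof -
  interpret periodic_graph n \<Gamma> by fact
  interpret rooted_periodic_graph n \<Gamma> x\<^sub>0 by unfold_locales fact
  \<comment> \<open>The quotient has finitely many cycles, so \<open>D\<close> is finite, and every
    extreme point of its hull lies in \<open>D\<close>.\<close>
  define D where "D = {cycle_direction \<Gamma> c | c. is_quotient_cycle \<Gamma> c} \<union> {0}"
  have P: "growth_polytope \<Gamma> = convex hull D" by (simp add: growth_polytope_def D_def)
  have "finite D" using Q.finite_cycles by (simp add: D_def is_quotient_cycle_def)
  have "polytope_vertices (growth_polytope \<Gamma>) \<subseteq> D"
    unfolding polytope_vertices_def P by (auto dest: extreme_point_of_convex_hull)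
  then show "finite S" unfolding S using \<open>finite D\<close> by (auto intro: finite_subset)
  define J where "J = insert 0 S"
  define w where "w v = (if v = 0 then 1 else cycle_weight \<Gamma> (q v))" for v
  have J: "finite J" "0 \<in> J" "w 0 = 1" "0 \<notin> S" using \<open>finite S\<close> by (auto simp: J_def w_def S)
  have cw: "cycle_weight \<Gamma> c > 0" if "is_quotient_cycle \<Gamma> c" for c
    using that length_le_walk_weight[of c]
    by (cases c) (auto simp: is_quotient_cycle_def Q.cycle_def)
  show w_S: "cycle_weight \<Gamma> (q v) > 0" if "v \<in> S" for v using q[OF that] cw by blast
  have w_pos: "w v > 0" if "v \<in> J" for v using that w_S by (auto simp: w_def J_def)
  have lab: "sum_list (map arc_label c) = real (cycle_weight \<Gamma> c) *\<^sub>R (cycle_direction \<Gamma> c, 1)"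
    if "is_quotient_cycle \<Gamma> c" for c
    using that cw[OF that] cycle_displacement_walk_shift[of c]
    by (simp add: sum_list_arc_label cycle_direction_def is_quotient_cycle_def)
  have lat: "real (cycle_weight \<Gamma> c) *\<^sub>R cycle_direction \<Gamma> c \<in> lattice \<Gamma>" if "is_quotient_cycle \<Gamma> c" for c
    using cw[OF that] quotient_cycle_lift[OF that] by (auto simp: cycle_direction_def)
  have loop: "\<exists>z. Q.awalk (vorbit \<Gamma> x\<^sub>0) z (vorbit \<Gamma> x\<^sub>0) \<and> sum_list (map arc_label z) = real (w v) *\<^sub>R (v, 1)"
    if "v \<in> J" "v \<noteq> 0" for v
  proof -
    have v: "is_quotient_cycle \<Gamma> (q v)" "cycle_direction \<Gamma> (q v) = v"
      "vorbit \<Gamma> x\<^sub>0 \<in> walk_supp (quotient_graph \<Gamma>) (q v)" using q that by (auto simp: J_def)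
    from Q.cycle_rotate[of "q v" "vorbit \<Gamma> x\<^sub>0" arc_label] v show ?thesis
      using lab[OF v(1)] that by (auto simp: is_quotient_cycle_def w_def)
  qed
  \<comment> \<open>By Krein-Milman the polytope is the hull of its extreme points, all of which lie
    in \<open>J\<close>.\<close>
  have hull: "growth_polytope \<Gamma> \<subseteq> convex hull J"
  proof -
    have "growth_polytope \<Gamma> = convex hull (polytope_vertices (growth_polytope \<Gamma>))"
      unfolding polytope_vertices_def P
      by (rule Krein_Milman_Minkowski) (use \<open>finite D\<close> in \<open>auto intro: finite_imp_compact_convex_hull\<close>)
    also have "\<dots> \<subseteq> convex hull J" by (rule hull_mono) (auto simp: J_def S)
    finally show ?thesis .
  qed
  have mult: "\<exists>k>0. \<exists>m. real k *\<^sub>R sum_list (map arc_label c) = (\<Sum>v\<in>J. real (m v * w v) *\<^sub>R (v, 1))"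
    if "Q.cycle c" for c
  proof -
    let ?w = "cycle_weight \<Gamma> c"
    have c: "is_quotient_cycle \<Gamma> c" using that by (simp add: is_quotient_cycle_def)
    have "cycle_direction \<Gamma> c \<in> growth_polytope \<Gamma>"
      unfolding P by (rule hull_inc) (use c in \<open>auto simp: D_def\<close>)
    then obtain u where u: "\<And>v. v \<in> J \<Longrightarrow> u v \<ge> 0" "sum u J = 1" "(\<Sum>v\<in>J. u v *\<^sub>R v) = cycle_direction \<Gamma> c"
      using hull unfolding convex_hull_finite[OF J(1)] by blast
    \<comment> \<open>The convex coefficients are rescaled to the lattice vectors
      \<open>w v * v\<close>; as they sum to 1, the same coefficients express the weight of
      \<open>c\<close> through the \<open>w v\<close>.\<close>
    have a: "real ?w *\<^sub>R cycle_direction \<Gamma> c = (\<Sum>v\<in>J. (real ?w * u v / real (w v)) *\<^sub>R (real (w v) *\<^sub>R v))"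
      unfolding u(3)[symmetric] scaleR_sum_right using w_pos by (intro sum.cong) auto
    have "(\<Sum>v\<in>J. real ?w * u v / real (w v) * real (w v)) = (\<Sum>v\<in>J. real ?w * u v)"
      using w_pos by (intro sum.cong) auto
    then have d: "real ?w = (\<Sum>v\<in>J. real ?w * u v / real (w v) * real (w v))"
      using u(2) by (simp flip: sum_distrib_left)
    have g: "real (w v) *\<^sub>R v \<in> lattice \<Gamma>" if "v \<in> J" for v
      using that q[of v] lat[of "q v"] lattice_zero by (cases "v = 0") (auto simp: J_def w_def)
    obtain k m where "k > 0" "real k *\<^sub>R (real ?w *\<^sub>R cycle_direction \<Gamma> c) = (\<Sum>v\<in>J. real (m v) *\<^sub>R (real (w v) *\<^sub>R v))"
      and d': "k * ?w = (\<Sum>v\<in>J. m v * w v)"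
      using lattice_cone_multiple[OF lattice J(1) g _ lat[OF c] a d] u(1) by auto
    moreover from d' have "real k * real ?w = (\<Sum>v\<in>J. real (m v * w v))"
      by (simp only: flip: of_nat_mult of_nat_sum)
    ultimately have "real k *\<^sub>R sum_list (map arc_label c) = (\<Sum>v\<in>J. real (m v * w v) *\<^sub>R (v, 1))"
      by (simp add: lab[OF c] prod_eq_iff fst_sum snd_sum)
    then show ?thesis using \<open>k > 0\<close> by blast
  qed
  obtain F where F: "finite F" "ball_module = (\<Union>z\<in>F. translate J w z ` exponents J)"
    using ball_module_finitely_generated[OF J(1-3) loop mult] by blast
  have "rational_over (\<Prod>v\<in>J. 1 - fps_X ^ w v) (hilbert_series (\<lambda>z. snd (snd z)) ball_module)"
    unfolding F(2)
  proof (rule hilbert_series_finitely_generated[where e = "\<lambda>z. snd (snd z)"])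
    fix i i' :: "'v set \<times> 'l \<times> nat" and c c' m :: "'l \<Rightarrow> nat"
    assume "translate J w i c = translate J w i' c'"
    then show "translate J w i (\<lambda>j. c j + m j) = translate J w i' (\<lambda>j. c' j + m j)"
      by (auto simp: translate_def split_beta sum.distrib distrib_right scaleR_add_left add.assoc[symmetric])
  qed (use F J w_pos in \<open>auto simp: translate_def exponent_degree_def split_beta\<close>)
  \<comment> \<open>Index 0 contributes the factor \<open>1 - X\<close>, which
    \<open>growth_series_eq\<close> absorbs.\<close>
  moreover have "(\<Prod>v\<in>J. 1 - fps_X ^ w v :: complex fps) = (1 - fps_X) * (\<Prod>v\<in>S. 1 - fps_X ^ cycle_weight \<Gamma> (q v))"
  proof -
    have "(\<Prod>v\<in>S. 1 - fps_X ^ w v :: complex fps) = (\<Prod>v\<in>S. 1 - fps_X ^ cycle_weight \<Gamma> (q v))"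
      using J(4) by (intro prod.cong) (auto simp: w_def)
    then show ?thesis using J \<open>finite S\<close> by (simp add: J_def)
  qed
  ultimately show "\<exists>Q. growth_series \<Gamma> x\<^sub>0 * (\<Prod>v\<in>S. 1 - fps_X ^ cycle_weight \<Gamma> (q v)) = fps_of_poly Q"
    by (simp add: rational_over_def growth_series_eq mult_ac)
qed

theorem theorem5p1:
  fixes \<Gamma> :: "('v, 'e, 'l::euclidean_space) periodic_graph_data"
    and n :: nat and x\<^sub>0 :: 'v and q :: "'l \<Rightarrow> 'e set list"
  assumes "periodic_graph n \<Gamma>"
    and "P_initial \<Gamma> x\<^sub>0"
    and "\<And>v. v \<in> polytope_vertices (growth_polytope \<Gamma>) - {0} \<Longrightarrow>
           is_quotient_cycle \<Gamma> (q v) \<and> cycle_direction \<Gamma> (q v) = v \<and>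
           vorbit \<Gamma> x\<^sub>0 \<in> walk_supp (quotient_graph \<Gamma>) (q v)"
  shows "has_quasi_period (\<lambda>d. of_nat (growth_seq \<Gamma> x\<^sub>0 d))
           (Lcm ((\<lambda>v. cycle_weight \<Gamma> (q v)) ` (polytope_vertices (growth_polytope \<Gamma>) - {0})))
       \<and> (\<exists>Q :: complex poly. growth_series \<Gamma> x\<^sub>0 =
           fps_of_poly Q /
           (\<Prod>v \<in> polytope_vertices (growth_polytope \<Gamma>) - {0}. 1 - fps_X ^ cycle_weight \<Gamma> (q v)))
       \<and> (unweighted \<Gamma> \<longrightarrow>
           has_quasi_period (\<lambda>d. of_nat (growth_seq \<Gamma> x\<^sub>0 d))
             (Lcm {1..card (verts (quotient_graph \<Gamma>))}))"
proof -
  define S where "S = polytope_vertices (growth_polytope \<Gamma>) - {0}"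
  let ?D = "\<Prod>v\<in>S. 1 - fps_X ^ cycle_weight \<Gamma> (q v) :: complex fps"
  have x\<^sub>0: "x\<^sub>0 \<in> verts (digraph_of \<Gamma>)" using assms(2) by (simp add: P_initial_def)
  have q: "v \<in> S \<Longrightarrow> is_quotient_cycle \<Gamma> (q v) \<and> cycle_direction \<Gamma> (q v) = v \<and>
           vorbit \<Gamma> x\<^sub>0 \<in> walk_supp (quotient_graph \<Gamma>) (q v)" for v
    using assms(3) unfolding S_def .
  have rat: "finite S" "v \<in> S \<Longrightarrow> cycle_weight \<Gamma> (q v) > 0"
    "\<exists>Q. growth_series \<Gamma> x\<^sub>0 * ?D = fps_of_poly Q" for v
    using growth_series_rational[OF assms(1) x\<^sub>0 S_def, of q] q by blast+
  obtain Q where Q: "growth_series \<Gamma> x\<^sub>0 * ?D = fps_of_poly Q" using rat(3) by blast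
  have growth: "(\<lambda>d. of_nat (growth_seq \<Gamma> x\<^sub>0 d)) = fps_nth (growth_series \<Gamma> x\<^sub>0)"
    by (rule ext) (simp add: growth_series_def)
  have period: "has_quasi_period (\<lambda>d. of_nat (growth_seq \<Gamma> x\<^sub>0 d)) N"
    if "N > 0" "\<And>v. v \<in> S \<Longrightarrow> cycle_weight \<Gamma> (q v) dvd N" for N
    unfolding growth by (rule has_quasi_period_prod[OF that Q])
  have "has_quasi_period (\<lambda>d. of_nat (growth_seq \<Gamma> x\<^sub>0 d)) (Lcm ((\<lambda>v. cycle_weight \<Gamma> (q v)) ` S))"
  proof (rule period)
    \<comment> \<open>A quasi-period must be positive, and the Lcm of a finite set is nonzero when 0
      is not a member.\<close>
    have "0 \<notin> (\<lambda>v. cycle_weight \<Gamma> (q v)) ` S"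
    proof
      assume "0 \<in> (\<lambda>v. cycle_weight \<Gamma> (q v)) ` S"
      then obtain v where "v \<in> S" "cycle_weight \<Gamma> (q v) = 0" by auto
      then show False using rat(2)[of v] by simp
    qed
    then have "Lcm ((\<lambda>v. cycle_weight \<Gamma> (q v)) ` S) \<noteq> 0"
      using rat(1) by (simp add: Lcm_0_iff)
    then show "Lcm ((\<lambda>v. cycle_weight \<Gamma> (q v)) ` S) > 0" by (rule neq0_conv[THEN iffD1])
  qed (auto intro: dvd_Lcm)
  moreover have "\<exists>Q. growth_series \<Gamma> x\<^sub>0 = fps_of_poly Q / ?D"
  proof -
    \<comment> \<open>The constant coefficient is 1 because the weight is positive; the denominator
      is then nonzero and can be divided out.\<close>
    have "1 - fps_X ^ cycle_weight \<Gamma> (q v) \<noteq> (0 :: complex fps)" if "v \<in> S" for v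
    proof
      assume "1 - fps_X ^ cycle_weight \<Gamma> (q v) = (0 :: complex fps)"
      from arg_cong[OF this, of "\<lambda>f. fps_nth f 0"] show False using rat(2)[OF that] by simp
    qed
    then have "?D \<noteq> 0" using rat(1) by (simp add: prod_zero_iff)
    then have "growth_series \<Gamma> x\<^sub>0 = fps_of_poly Q / ?D" unfolding Q[symmetric] by simp
    then show ?thesis ..
  qed
  moreover have "has_quasi_period (\<lambda>d. of_nat (growth_seq \<Gamma> x\<^sub>0 d)) (Lcm {1..card (verts (quotient_graph \<Gamma>))})"
    if unw: "unweighted \<Gamma>"
  proof (rule period)
    interpret periodic_graph n \<Gamma> by fact
    interpret rooted_periodic_graph n \<Gamma> x\<^sub>0 by unfold_locales fact
    have "Lcm {1..card (verts (quotient_graph \<Gamma>))} \<noteq> 0" by (simp add: Lcm_0_iff)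
    then show "Lcm {1..card (verts (quotient_graph \<Gamma>))} > 0" by (rule neq0_conv[THEN iffD1])
    fix v assume v: "v \<in> S"
    have cyc: "Q.cycle (q v)" using q[OF v] by (simp add: is_quotient_cycle_def)
    then have "set (q v) \<subseteq> arcs (quotient_graph \<Gamma>)" by (auto simp: Q.cycle_def)
    \<comment> \<open>With unit weights a cycle weighs its length, which is at most the number of
      vertex orbits.\<close>
    moreover have "cycle_weight \<Gamma> c = length c" if "set c \<subseteq> arcs (quotient_graph \<Gamma>)" for c
      using that unw by (induction c)
        (auto simp: walk_weight_def quotient_graph_sel quotient_weight_eorbit unweighted_def)
    ultimately have "cycle_weight \<Gamma> (q v) = length (q v)" by blast
    then have "cycle_weight \<Gamma> (q v) \<in> {1..card (verts (quotient_graph \<Gamma>))}"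
      using Q.length_cycle_le[OF cyc] rat(2)[OF v] unfolding atLeastAtMost_iff by linarith
    then show "cycle_weight \<Gamma> (q v) dvd Lcm {1..card (verts (quotient_graph \<Gamma>))}" by (rule dvd_Lcm)
  qed
  ultimately show ?thesis unfolding S_def by blast
qed

end
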